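(* Consider the three-dimensional (corner) PML equation in Laplace space on $\Omega=[-1,1]^3$, $$(sS_x)\,\mathbf P^{-1}\widetilde{\mathbf Q}=\sum_{\xi=x,y,z}\mathbf A_\xi\frac{\partial\widetilde{\mathbf Q}}{\partial\xi}+\mathbf P^{-1}\widetilde{\mathbf F},\qquad \widetilde{\mathbf F}=\mathbf P\Big(S_x\widetilde{\mathbf F}_Q-\sum_{\xi=x,y,z}\frac{d}{s+\alpha}\widetilde{\mathbf F}_{w_\xi}\Big),$$ with piecewise constant $d_x(x)=d_y(y)=d_z(z)=d\ge0$ and $\alpha_x=\alpha_y=\alpha_z=\alpha\ge0$, where $S_x=S_y=S_z=1+\frac{d}{s+\alpha}$, subject to the boundary conditions, for $\xi\in\{x,y,z\}$ and $\eta=x,y,z$, $$\tfrac{Z_\eta}{2}(1-\gamma_\eta)\widetilde v_\eta-\tfrac{1+\gamma_\eta}{2}\widetilde T_\eta=0\ \text{ at } \xi=-1,\qquad \tfrac{Z_\eta}{2}(1-\gamma_\eta)\widetilde v_\eta+\tfrac{1+\gamma_\eta}{2}\widetilde T_\eta=0\ \text{ at } \xi=1,$$ with real $|\gamma_\eta|\le1$, and to the interface conditions $\widetilde{\mathbf T}^+=\widetilde{\mathbf T}^-$, $\widetilde{\mathbf v}^+-\widetilde{\mathbf v}^-=0$ at discontinuities of $d_x(x)$, $d_y(y)$, $d_z(z)$. Then for all $s\in\mathbb C$ with $\Re(s)\ge a>0$ we have $\Re(sS_x)\ge a>0$ and $$\big\|\sqrt{\Re(sS_x)}\,\widetilde{\mathbf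 Q}(\cdot,\cdot,\cdot,s)\big\|_P^2\le\|\widetilde{\mathbf Q}(\cdot,\cdot,\cdot,s)\|_P\,\|\widetilde{\mathbf F}(\cdot,\cdot,\cdot,s)\|_P+\widetilde{\mathrm{BT}},$$ where $$\widetilde{\mathrm{BT}}=\sum_{\xi=x,y,z}\int_{[-1,1]^2}\tfrac12\Big[\widetilde{\mathbf Q}^\dagger\mathbf A_\xi\widetilde{\mathbf Q}\Big]\Big|_{\xi=-1}^{\xi=1}\,\frac{dx\,dy\,dz}{d\xi}\le0 .$$
   Context: The unknown is $\widetilde{\mathbf Q}=(\widetilde{\mathbf v},\widetilde{\boldsymbol\sigma})$ with values in $\mathbb C^9$: velocity $\widetilde{\mathbf v}=(\widetilde v_x,\widetilde v_y,\widetilde v_z)$ and stress $\widetilde{\boldsymbol\sigma}=(\sigma_{xx},\sigma_{yy},\sigma_{zz},\sigma_{xy},\sigma_{xz},\sigma_{yz})$. It is the Laplace transform in time (dual variable $s$) of the solution of the perfectly matched layer (PML) system for linear elastodynamics with zero initial data. "Piecewise constant" means that $\Omega$ is split by finitely many coordinate planes into boxes on each of which the common damping value $d$ is constant. Solutions are understood to be sufficiently regular (e.g. $H^1$) on each box, satisfying the equation there. $\widetilde{\mathbf F}_Q,\widetilde{\mathbf F}_{w_\xi}$ are given (Laplace-transformed) source terms in $L^2(\Omega)$. $\mathbf A_\xi=\begin{pmatrix}\mathbf 0_3&\mathbf a_\xi\\ \mathbf a_\xi^T&\mathbf 0_6\end{pmatrix}$, $\mathbf a_x=\begin{pmatrix}1&0&0&0&0&0\\0&0&0&1&0&0\\0&0&0&0&1&0\end{pmatrix}$,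 $\mathbf a_y=\begin{pmatrix}0&0&0&1&0&0\\0&1&0&0&0&0\\0&0&0&0&0&1\end{pmatrix}$, $\mathbf a_z=\begin{pmatrix}0&0&0&0&1&0\\0&0&0&0&0&1\\0&0&1&0&0&0\end{pmatrix}$. $\mathbf P=\mathrm{diag}(\rho^{-1}\mathbf 1_3,\mathbf C)$ is symmetric positive definite and may depend on position, with density $\rho>0$ and symmetric positive definite elastic stiffness matrix $\mathbf C\in\mathbb R^{6\times6}$. The traction on planes $\xi=\text{const}$ is $\widetilde{\mathbf T}=\mathbf a_\xi\widetilde{\boldsymbol\sigma}$, with components $\widetilde T_\eta$, $\eta=x,y,z$. The impedances on such planes are $Z_\eta=\rho c_\eta>0$, with $c_\eta=c_p$ if $\eta=\xi$ and $c_\eta=c_s$ if $\eta\neq\xi$ (P- and S-wave speeds; in the isotropic case with Lamé parameters $\lambda,\mu$: $c_p=\sqrt{(2\mu+\lambda)/\rho}$, $c_s=\sqrt{\mu/\rho}$). Superscripts $\pm$ denote the one-sided limits on the two sides of an interface, and $\dagger$ is the complex conjugate transpose. The notation $\frac{dx\,dy\,dz}{d\xi}$ means integration over the two coordinates other than $\xi$. The weighted inner product and norm are $(\mathbf Q,\mathbf F)_P=\int_\Omega\frac12\mathbf Q^\dagger\mathbf P^{-1}\mathbf F\,dx\,dy\,dz$ and $\|\mathbf Q\|_P^2=(\mathbf Q,\mathbf Q)_P$.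
   Formalization: The bound is proved with BT/2 in place of BT (BT itself defined as printed): with the factor 1/2 both in the P-norm and in BT, the energy identity gives BT/2, and since BT ≤ 0 the printed inequality is stronger and fails, e.g. for large real s whenever BT < 0. *)

theory Defs
  imports "HOL-Analysis.Analysis"
begin

section \<open>The elastic system in complex state vectors\<close>

text \<open>
  A state \<open>(v, \<sigma>)\<close> lives in \<open>complex ^ (3 + 6)\<close>: the components \<open>Inl k\<close> are the velocity
  \<open>(v_x, v_y, v_z)\<close>, the components \<open>Inr k\<close> the stress in the order
  \<open>(xx, yy, zz, xy, xz, yz)\<close>.  The directions \<open>x, y, z\<close> are the indices \<open>1, 2, 3 :: 3\<close>.
\<close>

type_synonym state = "complex ^ (3 + 6)"

definition velocity :: "state \<Rightarrow> complex ^ 3" where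
  "velocity q = (\<chi> k. q $ Inl k)"

definition stress :: "state \<Rightarrow> complex ^ 6" where
  "stress q = (\<chi> k. q $ Inr k)"

definition a_mat :: "3 \<Rightarrow> real ^ 6 ^ 3" where
  "a_mat \<xi> =
    (if \<xi> = 1 then
       vector [vector [1, 0, 0, 0, 0, 0],
               vector [0, 0, 0, 1, 0, 0],
               vector [0, 0, 0, 0, 1, 0]]
     else if \<xi> = 2 then
       vector [vector [0, 0, 0, 1, 0, 0],
               vector [0, 1, 0, 0, 0, 0],
               vector [0, 0, 0, 0, 0, 1]]
     else
       vector [vector [0, 0, 0, 0, 1, 0],
               vector [0, 0, 0, 0, 0, 1],
               vector [0, 0, 1, 0, 0, 0]])"

definition A_mat :: "3 \<Rightarrow> real ^ (3 + 6) ^ (3 + 6)" where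
  "A_mat \<xi> = (\<chi> i j. case (i, j) of
      (Inl k, Inr l) \<Rightarrow> a_mat \<xi> $ k $ l
    | (Inr k, Inl l) \<Rightarrow> transpose (a_mat \<xi>) $ k $ l
    | _ \<Rightarrow> 0)"

definition P_mat :: "real \<Rightarrow> real ^ 6 ^ 6 \<Rightarrow> real ^ (3 + 6) ^ (3 + 6)" where
  "P_mat \<rho> C = (\<chi> i j. case (i, j) of
      (Inl k, Inl l) \<Rightarrow> (if k = l then inverse \<rho> else 0)
    | (Inr k, Inr l) \<Rightarrow> C $ k $ l
    | _ \<Rightarrow> 0)"

definition sym_pos_def :: "real ^ 'n ^ 'n \<Rightarrow> bool" where
  "sym_pos_def M \<longleftrightarrow> transpose M = M \<and> (\<forall>v. v \<noteq> 0 \<longrightarrow> v \<bullet> (M *v v) > 0)"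

abbreviation cmat :: "real ^ 'n ^ 'm \<Rightarrow> complex ^ 'n ^ 'm" where
  "cmat M \<equiv> map_matrix complex_of_real M"

text \<open>The product \<open>u\<^sup>\<dagger> w\<close>, conjugate linear in the first argument
  (the library inner product on \<open>complex ^ 'n\<close> is only its real part).\<close>

definition hdot :: "complex ^ 'n \<Rightarrow> complex ^ 'n \<Rightarrow> complex" where
  "hdot u w = (\<Sum>i\<in>UNIV. cnj (u $ i) * w $ i)"

definition traction :: "3 \<Rightarrow> state \<Rightarrow> complex ^ 3" where
  "traction \<xi> q = cmat (a_mat \<xi>) *v stress q"

definition impedance :: "real \<Rightarrow> real \<Rightarrow> real \<Rightarrow> 3 \<Rightarrow> 3 \<Rightarrow> real" where
  "impedance \<rho> cp cs \<xi> \<eta> = \<rho> * (if \<eta> = \<xi> then cp else cs)"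

definition pml_S :: "real \<Rightarrow> real \<Rightarrow> complex \<Rightarrow> complex" where
  "pml_S d \<alpha> s = 1 + of_real d / (s + of_real \<alpha>)"

definition pml_source ::
  "real ^ (3 + 6) ^ (3 + 6) \<Rightarrow> real \<Rightarrow> real \<Rightarrow> complex \<Rightarrow> state \<Rightarrow> (3 \<Rightarrow> state) \<Rightarrow> state" where
  "pml_source P d \<alpha> s FQ Fw =
     cmat P *v (pml_S d \<alpha> s *s FQ - (\<Sum>\<xi>\<in>UNIV. (of_real d / (s + of_real \<alpha>)) *s Fw \<xi>))"


section \<open>The domain, the weighted norm and surface integrals\<close>

definition \<Omega> :: "(real ^ 3) set" where
  "\<Omega> = cbox (vec (- 1)) (vec 1)"

definition P_inner ::
  "(real ^ 3 \<Rightarrow> real ^ (3 + 6) ^ (3 + 6)) \<Rightarrow> (real ^ 3 \<Rightarrow> state) \<Rightarrow> (real ^ 3 \<Rightarrow> state) \<Rightarrow> complex" where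
  "P_inner P Q F = (\<integral>x. 1 / 2 * hdot (Q x) (cmat (matrix_inv (P x)) *v F x) \<partial>lebesgue_on \<Omega>)"

definition P_norm :: "(real ^ 3 \<Rightarrow> real ^ (3 + 6) ^ (3 + 6)) \<Rightarrow> (real ^ 3 \<Rightarrow> state) \<Rightarrow> real" where
  "P_norm P Q = sqrt (Re (P_inner P Q Q))"

text \<open>Two-dimensional Lebesgue measure on the plane \<open>{x. x $ \<xi> = c}\<close>, as a measure on the ambient
  space, and its restriction to the section of the box \<open>cbox l u\<close> by that plane.\<close>

definition plane_measure :: "3 \<Rightarrow> real \<Rightarrow> (real ^ 3) measure" where
  "plane_measure \<xi> c =
     distr (Pi\<^sub>M (UNIV - {\<xi>}) (\<lambda>_. lborel)) borel (\<lambda>\<omega>. \<chi> \<eta>. if \<eta> = \<xi> then c else \<omega> \<eta>)"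

definition face_measure :: "3 \<Rightarrow> real \<Rightarrow> real ^ 3 \<Rightarrow> real ^ 3 \<Rightarrow> (real ^ 3) measure" where
  "face_measure \<xi> c l u = restrict_space (plane_measure \<xi> c) (cbox l u)"

abbreviation \<Omega>_face :: "3 \<Rightarrow> real \<Rightarrow> (real ^ 3) measure" where
  "\<Omega>_face \<xi> c \<equiv> face_measure \<xi> c (vec (- 1)) (vec 1)"

text \<open>The matrices \<open>A_mat \<xi>\<close> are symmetric, so the form below is real; taking \<open>Re\<close>
  only changes the type.  As \<open>Re (q\<^sup>\<dagger> A \<partial>q) = \<partial>(q\<^sup>\<dagger> A q) / 2\<close>, this quantity enters the energy identity
  for the norm \<open>P_norm\<close> with the factor \<open>1 / 2\<close>.\<close>

definition boundary_term :: "(real ^ 3 \<Rightarrow> state) \<Rightarrow> real" where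
  "boundary_term q =
     (\<Sum>\<xi>\<in>UNIV. (\<integral>x. 1 / 2 * Re (hdot (q x) (cmat (A_mat \<xi>) *v q x)) \<partial>\<Omega>_face \<xi> 1)
              - (\<integral>x. 1 / 2 * Re (hdot (q x) (cmat (A_mat \<xi>) *v q x)) \<partial>\<Omega>_face \<xi> (- 1)))"


section \<open>Square integrability, weak derivatives and traces\<close>

definition L2 :: "'a measure \<Rightarrow> ('a \<Rightarrow> 'b :: euclidean_space) \<Rightarrow> bool" where
  "L2 M f \<longleftrightarrow> f \<in> borel_measurable M \<and> integrable M (\<lambda>x. (norm (f x))\<^sup>2)"

definition L2_tendsto ::
  "'a measure \<Rightarrow> (nat \<Rightarrow> 'a \<Rightarrow> 'b :: euclidean_space) \<Rightarrow> ('a \<Rightarrow> 'b) \<Rightarrow> bool" where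
  "L2_tendsto M \<phi> f \<longleftrightarrow> (\<forall>n. L2 M (\<phi> n)) \<and> L2 M f \<and>
     (\<lambda>n. \<integral>x. (norm (\<phi> n x - f x))\<^sup>2 \<partial>M) \<longlonglongrightarrow> 0"

definition partial :: "3 \<Rightarrow> (real ^ 3 \<Rightarrow> 'b :: euclidean_space) \<Rightarrow> real ^ 3 \<Rightarrow> 'b" where
  "partial \<xi> f x = frechet_derivative f (at x) (axis \<xi> 1)"

definition C1 :: "(real ^ 3 \<Rightarrow> 'b :: euclidean_space) \<Rightarrow> bool" where
  "C1 f \<longleftrightarrow> (\<forall>x. f differentiable (at x)) \<and> (\<forall>\<xi>. continuous_on UNIV (partial \<xi> f))"

definition weak_partial ::
  "(real ^ 3) set \<Rightarrow> 3 \<Rightarrow> (real ^ 3 \<Rightarrow> 'b :: euclidean_space) \<Rightarrow> (real ^ 3 \<Rightarrow> 'b) \<Rightarrow> bool" where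
  "weak_partial U \<xi> f g \<longleftrightarrow>
     (\<forall>\<phi> :: real ^ 3 \<Rightarrow> real.
        C1 \<phi> \<and> compact (closure {x. \<phi> x \<noteq> 0}) \<and> closure {x. \<phi> x \<noteq> 0} \<subseteq> U \<longrightarrow>
        (\<integral>x. partial \<xi> \<phi> x *\<^sub>R f x \<partial>lebesgue_on U) = - (\<integral>x. \<phi> x *\<^sub>R g x \<partial>lebesgue_on U))"

text \<open>\<open>f\<close> is in \<open>H\<^sup>1\<close> of the open set \<open>U\<close> with weak gradient \<open>g\<close>.\<close>

definition H1_on ::
  "(real ^ 3) set \<Rightarrow> (real ^ 3 \<Rightarrow> 'b :: euclidean_space) \<Rightarrow> (3 \<Rightarrow> real ^ 3 \<Rightarrow> 'b) \<Rightarrow> bool" where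
  "H1_on U f g \<longleftrightarrow> L2 (lebesgue_on U) f \<and>
     (\<forall>\<xi>. L2 (lebesgue_on U) (g \<xi>) \<and> weak_partial U \<xi> f (g \<xi>))"

text \<open>\<open>\<tau>\<close> is the trace, on the six faces of \<open>box l u\<close>, of the \<open>H\<^sup>1\<close> function \<open>f\<close> with weak gradient
  \<open>g\<close>: the trace operator is the continuous extension to \<open>H\<^sup>1\<close> of the restriction of functions that are
  continuously differentiable up to the boundary, and these are dense.\<close>

definition has_trace ::
  "real ^ 3 \<Rightarrow> real ^ 3 \<Rightarrow> (real ^ 3 \<Rightarrow> 'b :: euclidean_space) \<Rightarrow> (3 \<Rightarrow> real ^ 3 \<Rightarrow> 'b) \<Rightarrow>
   (real ^ 3 \<Rightarrow> 'b) \<Rightarrow> bool" where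
  "has_trace l u f g \<tau> \<longleftrightarrow>
     (\<exists>\<phi> :: nat \<Rightarrow> real ^ 3 \<Rightarrow> 'b. (\<forall>n. C1 (\<phi> n)) \<and>
        L2_tendsto (lebesgue_on (box l u)) \<phi> f \<and>
        (\<forall>\<xi>. L2_tendsto (lebesgue_on (box l u)) (\<lambda>n. partial \<xi> (\<phi> n)) (g \<xi>)) \<and>
        (\<forall>\<xi>. \<forall>c\<in>{l $ \<xi>, u $ \<xi>}. L2_tendsto (face_measure \<xi> c l u) \<phi> \<tau>))"


section \<open>Partition of the domain into boxes\<close>

text \<open>In direction \<open>\<xi>\<close> the cutting planes are \<open>x $ \<xi> = t \<xi> k\<close> with \<open>0 < k < n \<xi>\<close>.  A box is
  indexed by \<open>i\<close> with \<open>i \<xi> < n \<xi>\<close> for all \<open>\<xi>\<close>.\<close>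

definition is_grid :: "(3 \<Rightarrow> nat) \<Rightarrow> (3 \<Rightarrow> nat \<Rightarrow> real) \<Rightarrow> bool" where
  "is_grid n t \<longleftrightarrow> (\<forall>\<xi>. strict_mono_on {..n \<xi>} (t \<xi>) \<and> t \<xi> 0 = - 1 \<and> t \<xi> (n \<xi>) = 1)"

definition cells :: "(3 \<Rightarrow> nat) \<Rightarrow> (3 \<Rightarrow> nat) set" where
  "cells n = {i. \<forall>\<xi>. i \<xi> < n \<xi>}"

definition lower :: "(3 \<Rightarrow> nat \<Rightarrow> real) \<Rightarrow> (3 \<Rightarrow> nat) \<Rightarrow> real ^ 3" where
  "lower t i = (\<chi> \<xi>. t \<xi> (i \<xi>))"

definition upper :: "(3 \<Rightarrow> nat \<Rightarrow> real) \<Rightarrow> (3 \<Rightarrow> nat) \<Rightarrow> real ^ 3" where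
  "upper t i = (\<chi> \<xi>. t \<xi> (Suc (i \<xi>)))"

text \<open>A cell whose closure contains the point \<open>x\<close> of \<open>\<Omega>\<close>; ambiguous points, on common faces of
  cells, are assigned to the lower cell.  It glues the traces of the individual cells to one
  function on the boundary of \<open>\<Omega>\<close>; the choice matters only on a null set of each outer face.\<close>

definition cell_at :: "(3 \<Rightarrow> nat \<Rightarrow> real) \<Rightarrow> real ^ 3 \<Rightarrow> 3 \<Rightarrow> nat" where
  "cell_at t x = (\<lambda>\<xi>. LEAST k. x $ \<xi> \<le> t \<xi> (Suc k))"

definition outer_trace ::
  "(3 \<Rightarrow> nat \<Rightarrow> real) \<Rightarrow> ((3 \<Rightarrow> nat) \<Rightarrow> real ^ 3 \<Rightarrow> state) \<Rightarrow> real ^ 3 \<Rightarrow> state" where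
  "outer_trace t tr x = tr (cell_at t x) x"

end

theory Submission
  imports Defs
begin

text \<open>
The estimate is an energy identity followed by the Cauchy-Schwarz inequality.  Write \<open>R\<close> for the
inverse of \<open>P\<close>, multiply the equation by \<open>Q\<^sup>\<dagger>\<close> and take real parts.  As \<open>R\<close> is real, symmetric and
positive definite, \<open>Q\<^sup>\<dagger> R Q\<close> is real and nonnegative, so the left side becomes \<open>Re (s S) Q\<^sup>\<dagger> R Q\<close>.
As the \<open>A\<^sub>\<xi>\<close> are real, symmetric and constant in space, \<open>Re (Q\<^sup>\<dagger> A\<^sub>\<xi> \<partial>\<^sub>\<xi> Q)\<close> is half the derivative
of \<open>Q\<^sup>\<dagger> A\<^sub>\<xi> Q\<close>, and Gauss-Green turns its integral over a cell into fluxes through the faces of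
that cell (\<open>Gauss_Green_box_H1\<close>).  This works because the damping is the same in all three
directions: one scalar factor \<open>S\<close> multiplies the undifferentiated terms, and the derivative terms
remain free of it.

The flux through a face depends only on velocity and traction (\<open>flux_form_velocity_traction\<close>).  The
interface conditions therefore make the contributions of inner faces cancel in pairs, and what
remains is the boundary term (\<open>piecewise_H1_flux_balance\<close>).  Its sign is settled pointwise: the
boundary conditions make the traction a real multiple of the velocity, or the velocity zero, with
the sign for which no energy enters the domain (\<open>reflecting_boundary_sign\<close>,
\<open>boundary_term_nonpos\<close>).  The source term is bounded by the Cauchy-Schwarz inequality of the
weighted form (\<open>P_norm_Cauchy_Schwarz\<close>), and \<open>Re (s S) \<ge> Re s\<close> is an elementary computation
(\<open>pml_S_damping\<close>).

The coefficients are positive definite at each point but without uniform bounds, so it is not clear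
in advance that \<open>Q\<^sup>\<dagger> R Q\<close> is integrable.  The equation itself supplies this: it writes
\<open>s S Q\<^sup>\<dagger> R Q\<close> as a sum of products of square integrable functions, because \<open>R F\<close> is a linear
combination of the given sources whose coefficients are constant on each cell.  The trace of an
\<open>H\<^sup>1\<close> function is a limit of restrictions of \<open>C\<^sup>1\<close> functions.  For the latter, Gauss-Green is
Fubini's theorem and the fundamental theorem of calculus (\<open>Gauss_Green_box_C1\<close>), and convergence in
\<open>L\<^sup>2\<close> carries it over (\<open>L2_tendsto_integral_bilinear\<close>).
\<close>

section \<open>Hermitian forms with real symmetric matrices\<close>

lemma hdot_add_left: "hdot (u + v) w = hdot u w + hdot v w"
  by (simp add: hdot_def ring_distribs sum.distrib)

lemma hdot_add_right: "hdot u (v + w) = hdot u v + hdot u w"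
  by (simp add: hdot_def ring_distribs sum.distrib)

lemma hdot_diff_right: "hdot u (v - w) = hdot u v - hdot u w"
  by (simp add: hdot_def ring_distribs sum_subtractf)

lemma hdot_smult_left: "hdot (c *s u) w = cnj c * hdot u w"
  by (simp add: hdot_def sum_distrib_left mult_ac)

lemma hdot_smult_right: "hdot u (c *s w) = c * hdot u w"
  by (simp add: hdot_def sum_distrib_left mult_ac)

lemma hdot_sum_right: "hdot u (\<Sum>i\<in>I. w i) = (\<Sum>i\<in>I. hdot u (w i))"
  by (induction I rule: infinite_finite_induct) (simp_all add: hdot_add_right, simp_all add: hdot_def)

lemma scaleR_eq_smult: "r *\<^sub>R u = complex_of_real r *s u"
  unfolding vec_eq_iff by (simp add: scaleR_conv_of_real[where 'a = complex])

lemma bounded_bilinear_hdot_matrix: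
  "bounded_bilinear (\<lambda>u w. hdot u (cmat M *v w))"
  unfolding bilinear_conv_bounded_bilinear[symmetric] bilinear_def
  by (auto intro!: linearI simp: scaleR_eq_smult hdot_add_left hdot_add_right hdot_smult_left
      hdot_smult_right matrix_vector_right_distrib vector_scalar_commute scaleR_conv_of_real
      scaleR_conv_of_real[where 'a = complex])

lemma bounded_bilinear_hdot: "bounded_bilinear (\<lambda>u w :: complex ^ 'n. hdot u w)"
  unfolding bilinear_conv_bounded_bilinear[symmetric] bilinear_def
  by (auto intro!: linearI simp: scaleR_eq_smult hdot_add_left hdot_add_right hdot_smult_left
      hdot_smult_right scaleR_conv_of_real[where 'a = complex])

lemma cmat_mult: "cmat (M ** N) = cmat M ** cmat N"
  by (simp add: vec_eq_iff matrix_matrix_mult_def)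

lemma cmat_mat_1: "cmat (mat 1) = mat 1"
  by (simp add: vec_eq_iff mat_def)

lemma symmetric_matrix_nth: "transpose M = M \<Longrightarrow> M $ i $ j = M $ j $ i"
proof -
  assume "transpose M = M"
  moreover have "transpose M $ i $ j = M $ j $ i" by (simp add: transpose_def)
  ultimately show ?thesis by simp
qed

lemma hdot_symmetric_matrix:
  assumes "transpose M = M"
  shows "hdot w (cmat M *v u) = cnj (hdot u (cmat M *v w))"
proof -
  have M: "M $ i $ j = M $ j $ i" for i j
    by (rule symmetric_matrix_nth[OF assms])
  have "hdot w (cmat M *v u) = (\<Sum>i\<in>UNIV. \<Sum>j\<in>UNIV. cnj (w $ i) * (of_real (M $ i $ j) * u $ j))"
    by (simp add: hdot_def matrix_vector_mult_def sum_distrib_left)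
  also have "\<dots> = (\<Sum>j\<in>UNIV. \<Sum>i\<in>UNIV. cnj (w $ i) * (of_real (M $ i $ j) * u $ j))"
    by (rule sum.swap)
  also have "\<dots> = cnj (hdot u (cmat M *v w))"
    unfolding hdot_def matrix_vector_mult_def cnj_sum complex_cnj_mult vec_lambda_beta sum_distrib_left
    by (intro sum.cong refl) (simp add: M)
  finally show ?thesis .
qed

text \<open>Reality is what turns the real part of the tested equation into an energy identity: the factor
\<open>s S\<close> then enters only through \<open>Re (s S)\<close>.\<close>

lemma hdot_symmetric_matrix_real:
  assumes "transpose M = M"
  shows "hdot u (cmat M *v u) = of_real (Re (hdot u (cmat M *v u)))"
proof -
  have "Im (hdot u (cmat M *v u)) = 0"
    using arg_cong[OF hdot_symmetric_matrix[OF assms, of u u], of Im] by simp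
  then show ?thesis by (simp add: complex_eq_iff)
qed

lemma Re_hdot_matrix:
  "Re (hdot u (cmat M *v u)) =
     (\<chi> i. Re (u $ i)) \<bullet> (M *v (\<chi> i. Re (u $ i))) + (\<chi> i. Im (u $ i)) \<bullet> (M *v (\<chi> i. Im (u $ i)))"
  by (simp add: hdot_def matrix_vector_mult_def inner_vec_def sum.distrib[symmetric])

lemma sym_pos_def_hdot_nonneg:
  assumes "sym_pos_def M"
  shows "Re (hdot u (cmat M *v u)) \<ge> 0"
proof -
  have "v \<bullet> (M *v v) \<ge> 0" for v
    using assms by (cases "v = 0") (auto simp: sym_pos_def_def less_imp_le)
  then show ?thesis by (simp add: Re_hdot_matrix)
qed

text \<open>Symmetry of the inverse follows by inserting the factor \<open>M ** matrix_inv M = mat 1\<close>, and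
positivity from \<open>v \<bullet> (matrix_inv M *v v) = y \<bullet> (M *v y)\<close> for \<open>y = matrix_inv M *v v\<close>.\<close>

lemma sym_pos_def_matrix_inv:
  assumes "sym_pos_def M"
  shows "M ** matrix_inv M = mat 1" "matrix_inv M ** M = mat 1" "sym_pos_def (matrix_inv M)"
proof -
  have "x = 0" if "M *v x = 0" for x
    using assms that unfolding sym_pos_def_def by force
  then obtain B where "B ** M = mat 1"
    using matrix_left_invertible_ker by blast
  then have "invertible M"
    by (auto simp: invertible_def matrix_left_right_inverse)
  then have inv: "M ** matrix_inv M = mat 1 \<and> matrix_inv M ** M = mat 1"
    unfolding invertible_def matrix_inv_def by (rule someI_ex)
  then show inv1: "M ** matrix_inv M = mat 1" and inv2: "matrix_inv M ** M = mat 1" by auto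
  have sym: "transpose M = M" using assms by (simp add: sym_pos_def_def)
  have "transpose (matrix_inv M) ** M = mat 1"
    using arg_cong[OF inv1, of transpose] by (simp add: matrix_transpose_mul sym)
  then have "transpose (matrix_inv M) = matrix_inv M"
    by (metis inv1 matrix_mul_assoc matrix_mul_lid matrix_mul_rid)
  moreover have "v \<bullet> (matrix_inv M *v v) > 0" if "v \<noteq> 0" for v
  proof -
    define y where "y = matrix_inv M *v v"
    have v: "v = M *v y"
      by (simp add: y_def matrix_vector_mul_assoc inv1)
    have "y \<noteq> 0"
      using that v by auto
    then have "y \<bullet> (M *v y) > 0"
      using assms by (simp add: sym_pos_def_def)
    then show ?thesis
      using v y_def by (metis inner_commute)
  qed
  ultimately show "sym_pos_def (matrix_inv M)"
    by (simp add: sym_pos_def_def)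
qed

lemma sum_UNIV_Plus:
  "(\<Sum>i\<in>(UNIV :: ('a :: finite + 'b :: finite) set). f i) = (\<Sum>k\<in>UNIV. f (Inl k)) + (\<Sum>k\<in>UNIV. f (Inr k))"
  by (subst UNIV_Plus_UNIV[symmetric], subst sum.Plus) simp_all

lemma sym_pos_def_P_mat:
  assumes "\<rho> > 0" "sym_pos_def C"
  shows "sym_pos_def (P_mat \<rho> C)"
  unfolding sym_pos_def_def
proof (intro conjI allI impI)
  have C: "C $ i $ j = C $ j $ i" for i j
    using assms(2) by (intro symmetric_matrix_nth) (simp add: sym_pos_def_def)
  show "transpose (P_mat \<rho> C) = P_mat \<rho> C"
    by (auto simp: vec_eq_iff transpose_def P_mat_def split: sum.splits intro: C)
next
  fix v :: "real ^ (3 + 6)" assume "v \<noteq> 0"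
  define v1 v2 where "v1 = (\<chi> k. v $ Inl k)" and "v2 = (\<chi> k. v $ Inr k)"
  have "v1 \<noteq> 0 \<or> v2 \<noteq> 0"
  proof (rule ccontr)
    assume "\<not> ?thesis"
    then have "v $ i = 0" for i
      by (cases i) (auto simp: v1_def v2_def vec_eq_iff)
    with \<open>v \<noteq> 0\<close> show False by (simp add: vec_eq_iff)
  qed
  have delta: "(if b then c else 0) * y = (if b then c * y else 0)" for b and c y :: real
    by simp
  have "v \<bullet> (P_mat \<rho> C *v v) = inverse \<rho> * (v1 \<bullet> v1) + v2 \<bullet> (C *v v2)"
    by (simp add: inner_vec_def matrix_vector_mult_def sum_UNIV_Plus P_mat_def v1_def v2_def
        delta sum_distrib_left mult.left_commute)
  moreover have "inverse \<rho> * (v1 \<bullet> v1) \<ge> 0" "v1 \<noteq> 0 \<Longrightarrow> inverse \<rho> * (v1 \<bullet> v1) > 0"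
    using assms(1) by auto
  moreover have "v2 \<noteq> 0 \<Longrightarrow> v2 \<bullet> (C *v v2) > 0" "v2 \<bullet> (C *v v2) \<ge> 0"
    using assms(2) by (auto simp: sym_pos_def_def) (cases "v2 = 0", auto simp: less_imp_le)
  ultimately show "v \<bullet> (P_mat \<rho> C *v v) > 0"
    using \<open>v1 \<noteq> 0 \<or> v2 \<noteq> 0\<close> by (smt (verit))
qed

section \<open>Energy flux, damping and reflection\<close>

lemma transpose_A_mat: "transpose (A_mat \<xi>) = A_mat \<xi>"
  by (auto simp: vec_eq_iff transpose_def A_mat_def split: sum.splits)

text \<open>
Polarising the energy flux \<open>q\<^sup>\<dagger> A\<^sub>\<xi> q\<close> to a form in two arguments makes the results on
symmetric bounded bilinear forms applicable to it.
\<close>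

definition flux_form :: "3 \<Rightarrow> state \<Rightarrow> state \<Rightarrow> real" where
  "flux_form \<xi> p q = Re (hdot p (cmat (A_mat \<xi>) *v q))"

lemma bounded_bilinear_flux_form: "bounded_bilinear (flux_form \<xi>)"
proof -
  have "bounded_bilinear (\<lambda>p q. Re (hdot p (cmat (A_mat \<xi>) *v q)))"
    using bounded_bilinear_hdot_matrix[of "A_mat \<xi>"]
    unfolding bilinear_conv_bounded_bilinear[symmetric] bilinear_def
    by (auto intro: linear_compose[where g = Re, unfolded o_def] bounded_linear.linear[OF bounded_linear_Re])
  then show ?thesis unfolding flux_form_def[abs_def] .
qed

lemma flux_form_commute: "flux_form \<xi> p q = flux_form \<xi> q p"
  unfolding flux_form_def by (subst hdot_symmetric_matrix[OF transpose_A_mat]) simp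

text \<open>The two off-diagonal blocks of \<open>A_mat \<xi>\<close> are transposes of each other and so contribute
complex conjugate amounts.  Consequently the flux depends on the state only through velocity and
traction, which are exactly the quantities that the interface conditions make continuous and
that the boundary conditions couple.\<close>

lemma flux_form_velocity_traction:
  "flux_form \<xi> q q = 2 * (\<Sum>\<eta>\<in>UNIV. Re (cnj (velocity q $ \<eta>) * traction \<xi> q $ \<eta>))"
proof -
  let ?S = "\<Sum>k\<in>UNIV. \<Sum>l\<in>UNIV. cnj (q $ Inl k) * (of_real (a_mat \<xi> $ k $ l) * q $ Inr l)"
  have "hdot q (cmat (A_mat \<xi>) *v q) = ?S
      + (\<Sum>l\<in>UNIV. \<Sum>k\<in>UNIV. cnj (q $ Inr l) * (of_real (a_mat \<xi> $ k $ l) * q $ Inl k))"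
    by (simp add: hdot_def matrix_vector_mult_def sum_UNIV_Plus A_mat_def transpose_def sum_distrib_left)
  also have "(\<Sum>l\<in>UNIV. \<Sum>k\<in>UNIV. cnj (q $ Inr l) * (of_real (a_mat \<xi> $ k $ l) * q $ Inl k)) = cnj ?S"
    by (subst sum.swap) (simp add: mult_ac)
  also have "?S = (\<Sum>\<eta>\<in>UNIV. cnj (velocity q $ \<eta>) * traction \<xi> q $ \<eta>)"
    by (simp add: velocity_def traction_def stress_def matrix_vector_mult_def sum_distrib_left)
  finally show ?thesis by (simp add: flux_form_def)
qed

text \<open>The damping adds \<open>d Re (s / (s + \<alpha>))\<close> to \<open>Re s\<close>, and this is nonnegative because
\<open>Re (s (cnj s + \<alpha>)) = \<bar>s\<bar>\<^sup>2 + \<alpha> Re s\<close>.\<close>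

lemma pml_S_damping:
  assumes "d \<ge> 0" "\<alpha> \<ge> 0" "Re s > 0"
  shows "Re (s * pml_S d \<alpha> s) \<ge> Re s"
proof -
  have nz: "s + of_real \<alpha> \<noteq> 0"
    using assms by (auto simp: complex_eq_iff)
  have "Re (s / (s + of_real \<alpha>)) = (Re s * (Re s + \<alpha>) + (Im s)\<^sup>2) / ((Re s + \<alpha>)\<^sup>2 + (Im s)\<^sup>2)"
    by (simp add: Re_divide power2_eq_square)
  also have "\<dots> \<ge> 0"
    using assms by (intro divide_nonneg_nonneg add_nonneg_nonneg mult_nonneg_nonneg) auto
  finally have "d * Re (s / (s + of_real \<alpha>)) \<ge> 0"
    using assms by simp
  then have "Re (of_real d * (s / (s + of_real \<alpha>))) \<ge> 0"
    by (simp only: Re_complex_of_real Im_complex_of_real times_complex.sel)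
  then show ?thesis by (simp add: pml_S_def ring_distribs mult_ac)
qed

text \<open>Apart from the limit case \<open>\<gamma> = -1\<close>, where the condition forces \<open>v = 0\<close>, the condition says
that \<open>T\<close> is a nonpositive real multiple of \<open>v\<close>, so that no energy enters through the boundary.\<close>

lemma reflecting_boundary_sign:
  fixes v T :: complex
  assumes "Z > 0" "\<bar>\<gamma>\<bar> \<le> 1"
    and bc: "of_real (Z / 2 * (1 - \<gamma>)) * v + of_real ((1 + \<gamma>) / 2) * T = 0"
  shows "Re (cnj v * T) \<le> 0"
proof (cases "\<gamma> = -1")
  case True
  then have "v = 0" using assms by auto
  then show ?thesis by simp
next
  case False
  have "(1 + \<gamma>) / 2 * Re (cnj v * T) = Re (cnj v * (of_real ((1 + \<gamma>) / 2) * T))"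
    by simp argo
  also have "of_real ((1 + \<gamma>) / 2) * T = - of_real (Z / 2 * (1 - \<gamma>)) * v"
    using bc unfolding mult_minus_left eq_neg_iff_add_eq_0 by (simp add: add.commute)
  also have "Re (cnj v * (- of_real (Z / 2 * (1 - \<gamma>)) * v)) = - (Z / 2 * (1 - \<gamma>)) * (cmod v)\<^sup>2"
    unfolding cmod_power2 by (simp add: power2_eq_square) argo
  also have "\<dots> \<le> 0"
    using assms by (auto intro!: mult_nonneg_nonneg)
  finally have "(1 + \<gamma>) / 2 * Re (cnj v * T) \<le> 0" .
  moreover have "(1 + \<gamma>) / 2 > 0"
    using False assms(2) by simp
  ultimately show ?thesis
    by (smt (verit) mult_pos_pos)
qed

section \<open>Bilinear forms of square integrable functions\<close>

text \<open>The discriminant argument behind both Cauchy-Schwarz inequalities below; it also covers a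
degenerate leading coefficient.\<close>

lemma nonneg_quadratic_bound:
  fixes A B C :: real
  assumes "A \<ge> 0" "C \<ge> 0" and q: "\<And>r. 0 \<le> A * r\<^sup>2 + 2 * B * r + C"
  shows "\<bar>B\<bar> \<le> sqrt A * sqrt C"
proof -
  have "B\<^sup>2 \<le> A * C"
  proof (cases "A = 0")
    case True
    have "B = 0"
    proof (rule ccontr)
      assume "B \<noteq> 0"
      then show False
        using q[of "- (C + 1) / (2 * B)"] True by simp
    qed
    then show ?thesis using True by simp
  next
    case False
    then have "A > 0" using assms by simp
    then show ?thesis
      using q[of "- B / A"] by (simp add: field_simps power2_eq_square)
  qed
  then have "sqrt (B\<^sup>2) \<le> sqrt (A * C)" by (rule real_sqrt_le_mono)
  then show ?thesis by (simp add: real_sqrt_mult)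
qed

lemma L2_measurable: "L2 M f \<Longrightarrow> f \<in> borel_measurable M"
  by (simp add: L2_def)

lemma borel_measurable_bounded_bilinear:
  fixes B :: "'b :: euclidean_space \<Rightarrow> 'c :: euclidean_space \<Rightarrow> 'd :: euclidean_space"
  assumes "bounded_bilinear B" "f \<in> borel_measurable M" "g \<in> borel_measurable M"
  shows "(\<lambda>x. B (f x) (g x)) \<in> borel_measurable M"
  using assms(2,3)
  by (rule borel_measurable_continuous_Pair)
    (auto intro!: bounded_bilinear.continuous_on[OF assms(1)] continuous_intros)

lemma L2_integrable_bilinear:
  fixes B :: "'b :: euclidean_space \<Rightarrow> 'c :: euclidean_space \<Rightarrow> 'd :: euclidean_space"
  assumes B: "bounded_bilinear B" and f: "L2 M f" and g: "L2 M g"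
  shows "integrable M (\<lambda>x. B (f x) (g x))"
proof -
  obtain K where K: "K > 0" "\<And>a b. norm (B a b) \<le> norm a * norm b * K"
    using bounded_bilinear.pos_bounded[OF B] by blast
  have "integrable M (\<lambda>x. ((norm (f x))\<^sup>2 + (norm (g x))\<^sup>2) * K)"
    using f g by (intro integrable_mult_left Bochner_Integration.integrable_add) (auto simp: L2_def)
  then show ?thesis
  proof (rule Bochner_Integration.integrable_bound)
    show "(\<lambda>x. B (f x) (g x)) \<in> borel_measurable M"
      by (rule borel_measurable_bounded_bilinear[OF B L2_measurable[OF f] L2_measurable[OF g]])
    have "norm (B a b) \<le> norm (((norm a)\<^sup>2 + (norm b)\<^sup>2) * K)" for a b
    proof -
      have "norm a * norm b \<le> (norm a)\<^sup>2 + (norm b)\<^sup>2"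
        using sum_squares_bound[of "norm a" "norm b"] mult_nonneg_nonneg[OF norm_ge_zero norm_ge_zero, of a b] by linarith
      then have "norm a * norm b * K \<le> ((norm a)\<^sup>2 + (norm b)\<^sup>2) * K"
        using K by (intro mult_right_mono) auto
      with K(2)[of a b] show ?thesis by simp
    qed
    then show "AE x in M. norm (B (f x) (g x)) \<le> norm (((norm (f x))\<^sup>2 + (norm (g x))\<^sup>2) * K)"
      by simp
  qed
qed

lemma L2_integrable_norm_mult:
  assumes "L2 M f" "L2 M g"
  shows "integrable M (\<lambda>x. norm (f x) * norm (g x))"
proof -
  have "L2 M (\<lambda>x. norm (f x))" "L2 M (\<lambda>x. norm (g x))"
    using assms by (auto simp: L2_def)
  from L2_integrable_bilinear[OF bounded_bilinear_mult this] show ?thesis .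
qed

lemma L2_Cauchy_Schwarz:
  assumes f: "L2 M f" and g: "L2 M g"
  shows "(\<integral>x. norm (f x) * norm (g x) \<partial>M)
      \<le> sqrt (\<integral>x. (norm (f x))\<^sup>2 \<partial>M) * sqrt (\<integral>x. (norm (g x))\<^sup>2 \<partial>M)"
proof -
  have "0 \<le> (\<integral>x. (norm (f x))\<^sup>2 \<partial>M) * r\<^sup>2 + 2 * (\<integral>x. norm (f x) * norm (g x) \<partial>M) * r
          + (\<integral>x. (norm (g x))\<^sup>2 \<partial>M)" for r
  proof -
    have "0 \<le> (\<integral>x. (norm (f x) * r + norm (g x))\<^sup>2 \<partial>M)"
      by simp
    also have "\<dots> = (\<integral>x. (norm (f x))\<^sup>2 * r\<^sup>2 + norm (f x) * norm (g x) * (2 * r) + (norm (g x))\<^sup>2 \<partial>M)"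
      by (simp add: power2_eq_square algebra_simps)
    also have "\<dots> = (\<integral>x. (norm (f x))\<^sup>2 \<partial>M) * r\<^sup>2 + (\<integral>x. norm (f x) * norm (g x) \<partial>M) * (2 * r)
          + (\<integral>x. (norm (g x))\<^sup>2 \<partial>M)"
      using f g L2_integrable_norm_mult[OF f g] by (simp add: L2_def)
    finally show ?thesis by (simp add: mult_ac)
  qed
  then show ?thesis
    using nonneg_quadratic_bound[of "\<integral>x. (norm (f x))\<^sup>2 \<partial>M" "\<integral>x. (norm (g x))\<^sup>2 \<partial>M"
        "\<integral>x. norm (f x) * norm (g x) \<partial>M"] by simp
qed

lemma L2_diff:
  assumes f: "L2 M f" and g: "L2 M g"
  shows "L2 M (\<lambda>x. f x - g x)"
proof -
  have "integrable M (\<lambda>x. inner (f x - g x) (f x - g x))"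
    using f g
    by (simp add: inner_diff_left inner_diff_right L2_integrable_bilinear[OF bounded_bilinear_inner])
  then show ?thesis
    using f g by (auto simp: L2_def power2_norm_eq_inner)
qed

text \<open>With \<open>a = \<phi>\<^sub>n - f\<close> and \<open>b = \<psi>\<^sub>n - g\<close> the difference of the integrands is
\<open>B a b + B a g + B f b\<close>; by Cauchy-Schwarz each of the three integrals tends to zero.  This
carries Gauss-Green from smooth approximations to \<open>H\<^sup>1\<close> functions and their traces.\<close>

lemma L2_tendsto_integral_bilinear:
  fixes B :: "'b :: euclidean_space \<Rightarrow> 'c :: euclidean_space \<Rightarrow> 'd :: euclidean_space"
  assumes B: "bounded_bilinear B" and f: "L2_tendsto M \<phi> f" and g: "L2_tendsto M \<psi> g"
  shows "(\<lambda>n. \<integral>x. B (\<phi> n x) (\<psi> n x) \<partial>M) \<longlonglongrightarrow> (\<integral>x. B (f x) (g x) \<partial>M)"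
proof -
  obtain K where K: "K > 0" "\<And>a b. norm (B a b) \<le> norm a * norm b * K"
    using bounded_bilinear.pos_bounded[OF B] by blast
  have L2: "L2 M (\<phi> n)" "L2 M f" "L2 M (\<psi> n)" "L2 M g" for n
    using f g by (auto simp: L2_tendsto_def)
  define F where "F n = sqrt (\<integral>x. (norm (\<phi> n x - f x))\<^sup>2 \<partial>M)" for n
  define G where "G n = sqrt (\<integral>x. (norm (\<psi> n x - g x))\<^sup>2 \<partial>M)" for n
  define f0 where "f0 = sqrt (\<integral>x. (norm (f x))\<^sup>2 \<partial>M)"
  define g0 where "g0 = sqrt (\<integral>x. (norm (g x))\<^sup>2 \<partial>M)"
  have F: "F \<longlonglongrightarrow> 0" and G: "G \<longlonglongrightarrow> 0"
    using f g tendsto_real_sqrt[where x = 0] by (auto simp: L2_tendsto_def F_def[abs_def] G_def[abs_def])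
  have bound: "norm ((\<integral>x. B (\<phi> n x) (\<psi> n x) \<partial>M) - (\<integral>x. B (f x) (g x) \<partial>M))
      \<le> (F n * G n + F n * g0 + f0 * G n) * K" for n
  proof -
    let ?a = "\<lambda>x. \<phi> n x - f x" and ?b = "\<lambda>x. \<psi> n x - g x"
    have ab: "L2 M ?a" "L2 M ?b"
      using L2 by (auto intro: L2_diff)
    have int: "integrable M (\<lambda>x. B (?a x) (?b x))" "integrable M (\<lambda>x. B (?a x) (g x))"
        "integrable M (\<lambda>x. B (f x) (?b x))"
      using ab L2 by (auto intro: L2_integrable_bilinear[OF B])
    have nint: "integrable M (\<lambda>x. norm (?a x) * norm (?b x))" "integrable M (\<lambda>x. norm (?a x) * norm (g x))"
        "integrable M (\<lambda>x. norm (f x) * norm (?b x))"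
      using ab L2 by (auto intro: L2_integrable_norm_mult)
    have "(\<integral>x. B (\<phi> n x) (\<psi> n x) \<partial>M) - (\<integral>x. B (f x) (g x) \<partial>M)
        = (\<integral>x. B (\<phi> n x) (\<psi> n x) - B (f x) (g x) \<partial>M)"
      using L2 by (intro Bochner_Integration.integral_diff[symmetric] L2_integrable_bilinear[OF B])
    also have "\<dots> = (\<integral>x. B (?a x) (?b x) + B (?a x) (g x) + B (f x) (?b x) \<partial>M)"
      by (simp add: bounded_bilinear.diff_left[OF B] bounded_bilinear.diff_right[OF B])
    also have "norm \<dots> \<le> (\<integral>x. norm (B (?a x) (?b x) + B (?a x) (g x) + B (f x) (?b x)) \<partial>M)"
      by (rule integral_norm_bound)
    also have "\<dots> \<le> (\<integral>x. (norm (?a x) * norm (?b x) + norm (?a x) * norm (g x) + norm (f x) * norm (?b x)) * K \<partial>M)"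
    proof (rule integral_mono)
      show "integrable M (\<lambda>x. norm (B (?a x) (?b x) + B (?a x) (g x) + B (f x) (?b x)))"
        using int by (intro integrable_norm Bochner_Integration.integrable_add)
      show "integrable M (\<lambda>x. (norm (?a x) * norm (?b x) + norm (?a x) * norm (g x) + norm (f x) * norm (?b x)) * K)"
        using nint by (intro integrable_mult_left Bochner_Integration.integrable_add)
      show "norm (B (?a x) (?b x) + B (?a x) (g x) + B (f x) (?b x))
          \<le> (norm (?a x) * norm (?b x) + norm (?a x) * norm (g x) + norm (f x) * norm (?b x)) * K" for x
        unfolding distrib_right by (intro order_trans[OF norm_triangle_ineq] add_mono K(2))
    qed
    also have "\<dots> = ((\<integral>x. norm (?a x) * norm (?b x) \<partial>M) + (\<integral>x. norm (?a x) * norm (g x) \<partial>M)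
        + (\<integral>x. norm (f x) * norm (?b x) \<partial>M)) * K"
      using nint by simp
    also have "\<dots> \<le> (F n * G n + F n * g0 + f0 * G n) * K"
      unfolding F_def G_def f0_def g0_def using ab L2 K
      by (intro mult_right_mono add_mono L2_Cauchy_Schwarz) auto
    finally show ?thesis .
  qed
  have "(\<lambda>n. (F n * G n + F n * g0 + f0 * G n) * K) \<longlonglongrightarrow> (0 * 0 + 0 * g0 + f0 * 0) * K"
    by (intro tendsto_intros F G)
  then have "(\<lambda>n. (F n * G n + F n * g0 + f0 * G n) * K) \<longlonglongrightarrow> 0" by simp
  then have "(\<lambda>n. (\<integral>x. B (\<phi> n x) (\<psi> n x) \<partial>M) - (\<integral>x. B (f x) (g x) \<partial>M)) \<longlonglongrightarrow> 0"
    by (rule tendsto_0_le[where K = 1])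
      (use bound in \<open>auto intro!: always_eventually order_trans[OF bound] abs_ge_self\<close>)
  then show ?thesis by (rule LIM_zero_cancel)
qed

section \<open>Gauss-Green on a box\<close>

text \<open>
The embedding of the coordinates other than \<open>\<xi>\<close> as the plane \<open>x $ \<xi> = c\<close>, so that
\<open>plane_measure\<close> is an image measure under \<open>slice\<close>.  Letting \<open>c\<close> vary sweeps out the whole
space, which is how Fubini's theorem is used.
\<close>

definition slice :: "3 \<Rightarrow> real \<Rightarrow> (3 \<Rightarrow> real) \<Rightarrow> real ^ 3" where
  "slice \<xi> c \<omega> = (\<chi> \<eta>. if \<eta> = \<xi> then c else \<omega> \<eta>)"

interpretation lebesgue_line: product_sigma_finite "\<lambda>_ :: 3. lborel :: real measure" ..

lemma borel_measurable_vec_iff: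
  "(f :: 'a \<Rightarrow> real ^ 'n) \<in> borel_measurable M \<longleftrightarrow> (\<forall>i. (\<lambda>x. f x $ i) \<in> borel_measurable M)"
  by (subst borel_measurable_euclidean_space) (auto simp: Basis_vec_def inner_axis)

lemma vec_measurable_PiM [measurable]:
  "(\<lambda>\<omega>. \<chi> \<eta>. \<omega> \<eta>) \<in> borel_measurable (Pi\<^sub>M (UNIV :: 3 set) (\<lambda>_. lborel :: real measure))"
  by (subst borel_measurable_vec_iff) simp

lemma slice_measurable [measurable]:
  "slice \<xi> c \<in> borel_measurable (Pi\<^sub>M (UNIV - {\<xi>}) (\<lambda>_. lborel))"
  unfolding slice_def[abs_def]
proof (subst borel_measurable_vec_iff, intro allI)
  fix \<eta>
  show "(\<lambda>\<omega>. (\<chi> \<eta>. if \<eta> = \<xi> then c else \<omega> \<eta>) $ \<eta>)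
      \<in> borel_measurable (Pi\<^sub>M (UNIV - {\<xi>}) (\<lambda>_. lborel))"
    by (cases "\<eta> = \<xi>") auto
qed

lemma plane_measure_eq: "plane_measure \<xi> c = distr (Pi\<^sub>M (UNIV - {\<xi>}) (\<lambda>_. lborel)) borel (slice \<xi> c)"
  by (simp add: plane_measure_def slice_def[abs_def])

lemma sets_plane_measure [simp, measurable_cong]: "sets (plane_measure \<xi> c) = sets borel"
  by (simp add: plane_measure_eq)

lemma space_plane_measure [simp]: "space (plane_measure \<xi> c) = UNIV"
  by (simp add: plane_measure_eq)

lemma integral_plane_measure:
  fixes f :: "real ^ 3 \<Rightarrow> 'b :: {banach, second_countable_topology}"
  assumes "f \<in> borel_measurable borel"
  shows "(\<integral>x. f x \<partial>plane_measure \<xi> c) = (\<integral>\<omega>. f (slice \<xi> c \<omega>) \<partial>Pi\<^sub>M (UNIV - {\<xi>}) (\<lambda>_. lborel))"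
  unfolding plane_measure_eq using assms by (intro integral_distr) auto

lemma AE_plane_measure_coordinate: "AE x in plane_measure \<xi> c. x $ \<xi> = c"
  unfolding plane_measure_eq by (subst AE_distr_iff) (auto simp: slice_def)

lemma integral_face_measure:
  fixes f :: "real ^ 3 \<Rightarrow> 'b :: {banach, second_countable_topology}"
  shows "(\<integral>x. f x \<partial>face_measure \<xi> c l u) = (\<integral>x. indicator (cbox l u) x *\<^sub>R f x \<partial>plane_measure \<xi> c)"
  unfolding face_measure_def by (intro integral_restrict_space) simp

lemma integrable_face_measure:
  fixes f :: "real ^ 3 \<Rightarrow> 'b :: {banach, second_countable_topology}"
  shows "integrable (face_measure \<xi> c l u) f
    \<longleftrightarrow> integrable (plane_measure \<xi> c) (\<lambda>x. indicator (cbox l u) x *\<^sub>R f x)"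
  unfolding face_measure_def by (intro integrable_restrict_space) simp

lemma AE_face_measure: "(AE x in face_measure \<xi> c l u. R x) \<longleftrightarrow> (AE x in plane_measure \<xi> c. x \<in> cbox l u \<longrightarrow> R x)"
  unfolding face_measure_def by (intro AE_restrict_space_iff) simp

lemma AE_PiM_lborel_coordinate_neq:
  assumes "\<eta> \<in> I"
  shows "AE \<omega> in Pi\<^sub>M I (\<lambda>_ :: 3. lborel :: real measure). \<omega> \<eta> \<noteq> c"
proof (rule AE_I')
  let ?A = "\<lambda>i. if i = \<eta> then {c} else UNIV :: real set"
  have "emeasure (Pi\<^sub>M I (\<lambda>_. lborel)) (Pi\<^sub>E I ?A) = (\<Prod>i\<in>I. emeasure lborel (?A i))"
    by (intro lebesgue_line.emeasure_PiM) auto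
  also have "\<dots> = 0"
    using assms by (intro prod_zero) auto
  finally show "Pi\<^sub>E I ?A \<in> null_sets (Pi\<^sub>M I (\<lambda>_. lborel))"
    by (auto intro!: null_setsI sets_PiM_I_finite)
  show "{\<omega> \<in> space (Pi\<^sub>M I (\<lambda>_. lborel)). \<not> \<omega> \<eta> \<noteq> c} \<subseteq> Pi\<^sub>E I ?A"
    by (auto simp: space_PiM PiE_iff extensional_def)
qed

text \<open>Needed to discard the edges in which neighbouring faces of cells overlap.\<close>

lemma AE_plane_measure_coordinate_neq:
  assumes "\<eta> \<noteq> \<xi>"
  shows "AE x in plane_measure \<xi> c. x $ \<eta> \<noteq> b"
proof -
  have "AE \<omega> in Pi\<^sub>M (UNIV - {\<xi>}) (\<lambda>_. lborel). \<omega> \<eta> \<noteq> b"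
    using assms by (intro AE_PiM_lborel_coordinate_neq) auto
  then show ?thesis
    unfolding plane_measure_eq using assms by (subst AE_distr_iff) (auto simp: slice_def)
qed

lemma lborel_eq_distr_PiM:
  "(lborel :: (real ^ 3) measure) = distr (Pi\<^sub>M UNIV (\<lambda>_. lborel)) borel (\<lambda>\<omega>. \<chi> \<eta>. \<omega> \<eta>)"
proof (rule lborel_eqI)
  fix l u :: "real ^ 3"
  assume le: "\<And>b. b \<in> Basis \<Longrightarrow> l \<bullet> b \<le> u \<bullet> b"
  have le': "l $ i \<le> u $ i" for i
    using le[of "axis i 1"] by (simp add: cart_eq_inner_axis)
  have "emeasure (distr (Pi\<^sub>M UNIV (\<lambda>_. lborel)) borel (\<lambda>\<omega>. \<chi> \<eta>. \<omega> \<eta>)) (box l u)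
      = emeasure (Pi\<^sub>M UNIV (\<lambda>_. lborel)) (Pi\<^sub>E UNIV (\<lambda>\<eta>. {l $ \<eta><..<u $ \<eta>}))"
    by (subst emeasure_distr)
      (auto simp: space_PiM mem_box_cart PiE_iff intro!: arg_cong2[where f = emeasure])
  also have "\<dots> = (\<Prod>\<eta>\<in>UNIV. emeasure lborel {l $ \<eta><..<u $ \<eta>})"
    by (intro lebesgue_line.emeasure_PiM) auto
  also have "\<dots> = ennreal (\<Prod>\<eta>\<in>UNIV. (u - l) $ \<eta>)"
    using le' by (simp add: prod_ennreal)
  also have "(\<Prod>\<eta>\<in>UNIV. (u - l) $ \<eta>) = (\<Prod>b\<in>Basis. (u - l) \<bullet> b)"
    unfolding Basis_vec_def
    by (simp add: UNION_singleton_eq_range prod.reindex inj_on_def axis_eq_axis cart_eq_inner_axis)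
  finally show "emeasure (distr (Pi\<^sub>M UNIV (\<lambda>_. lborel)) borel (\<lambda>\<omega>. \<chi> \<eta>. \<omega> \<eta>)) (box l u)
      = ennreal (\<Prod>b\<in>Basis. (u - l) \<bullet> b)" .
qed simp

lemma integral_lborel_slices:
  fixes f :: "real ^ 3 \<Rightarrow> real"
  assumes "integrable lborel f"
  shows "(\<integral>x. f x \<partial>lborel) = (\<integral>\<omega>. (\<integral>y. f (slice \<xi> y \<omega>) \<partial>lborel) \<partial>Pi\<^sub>M (UNIV - {\<xi>}) (\<lambda>_. lborel))"
proof -
  have ins: "insert \<xi> (UNIV - {\<xi>}) = (UNIV :: 3 set)" by auto
  have f [measurable]: "f \<in> borel_measurable borel"
    using borel_measurable_integrable[OF assms] by simp
  have int: "integrable (Pi\<^sub>M (insert \<xi> (UNIV - {\<xi>})) (\<lambda>_. lborel)) (\<lambda>\<omega>. f (\<chi> \<eta>. \<omega> \<eta>))"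
    using assms unfolding ins lborel_eq_distr_PiM by (subst (asm) integrable_distr_eq) auto
  have "(\<integral>x. f x \<partial>lborel) = (\<integral>\<omega>. f (\<chi> \<eta>. \<omega> \<eta>) \<partial>Pi\<^sub>M (insert \<xi> (UNIV - {\<xi>})) (\<lambda>_. lborel))"
    unfolding ins lborel_eq_distr_PiM by (subst integral_distr) auto
  also have "\<dots> = (\<integral>\<omega>. (\<integral>y. f (\<chi> \<eta>. fun_upd \<omega> \<xi> y \<eta>) \<partial>lborel) \<partial>Pi\<^sub>M (UNIV - {\<xi>}) (\<lambda>_. lborel))"
    by (intro lebesgue_line.product_integral_insert int) auto
  finally show ?thesis by (simp add: slice_def fun_upd_def)
qed

lemma slice_in_cbox:
  "slice \<xi> c \<omega> \<in> cbox l u \<longleftrightarrow> c \<in> {l $ \<xi>..u $ \<xi>} \<and> (\<forall>\<eta>. \<eta> \<noteq> \<xi> \<longrightarrow> \<omega> \<eta> \<in> {l $ \<eta>..u $ \<eta>})"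
  by (auto simp: mem_box_cart slice_def split: if_splits)

lemma AE_lborel_cbox_box: "AE x in lborel. x \<in> cbox l u \<longrightarrow> x \<in> box l (u :: real ^ 3)"
proof -
  have "AE x in lborel. x \<notin> cbox l u - box l u"
    using negligible_frontier_interval[of l u]
    by (intro AE_not_in) (auto simp: negligible_iff_null_sets null_sets_completion_iff)
  then show ?thesis by auto
qed

lemma slice_has_vector_derivative:
  assumes "\<And>x. h differentiable (at x)"
  shows "((\<lambda>y. h (slice \<xi> y \<omega>)) has_vector_derivative partial \<xi> h (slice \<xi> y \<omega>)) (at y within S)"
proof -
  have s: "slice \<xi> y \<omega> = slice \<xi> 0 \<omega> + y *\<^sub>R axis \<xi> 1" for y
    by (auto simp: slice_def vec_eq_iff axis_def)
  have "((\<lambda>y. slice \<xi> 0 \<omega> + y *\<^sub>R axis \<xi> 1) has_derivative (\<lambda>y. y *\<^sub>R axis \<xi> 1)) (at y within S)"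
    by (auto intro!: derivative_eq_intros)
  moreover have "(h has_derivative frechet_derivative h (at (slice \<xi> y \<omega>))) (at (slice \<xi> 0 \<omega> + y *\<^sub>R axis \<xi> 1))"
    using assms by (simp add: s[symmetric] frechet_derivative_works[symmetric])
  ultimately have "((\<lambda>y. h (slice \<xi> 0 \<omega> + y *\<^sub>R axis \<xi> 1)) has_derivative
      (\<lambda>z. frechet_derivative h (at (slice \<xi> y \<omega>)) (z *\<^sub>R axis \<xi> 1))) (at y within S)"
    by (rule has_derivative_compose)
  moreover have "linear (frechet_derivative h (at (slice \<xi> y \<omega>)))"
    using assms by (rule linear_frechet_derivative)
  ultimately show ?thesis
    by (simp add: has_vector_derivative_def partial_def s[symmetric] linear_scale)
qed

lemma C1_continuous: "C1 f \<Longrightarrow> continuous_on S f"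
  unfolding C1_def by (meson continuous_at_imp_continuous_on differentiable_imp_continuous_within)

text \<open>On each line in direction \<open>\<xi>\<close> the fundamental theorem of calculus applies; integrating over the
remaining coordinates turns the end point values into the two face integrals.\<close>

proposition Gauss_Green_box_C1:
  fixes h :: "real ^ 3 \<Rightarrow> real"
  assumes h: "C1 h" and le: "\<And>\<eta>. l $ \<eta> \<le> u $ \<eta>"
  shows "(\<integral>x. partial \<xi> h x \<partial>lebesgue_on (box l u))
    = (\<integral>x. h x \<partial>face_measure \<xi> (u $ \<xi>) l u) - (\<integral>x. h x \<partial>face_measure \<xi> (l $ \<xi>) l u)"
proof -
  have diff: "\<And>x. h differentiable (at x)" and cont: "continuous_on UNIV (partial \<xi> h)"
    using h by (auto simp: C1_def)
  have conth: "continuous_on UNIV h"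
    using h by (rule C1_continuous)
  have [measurable]: "h \<in> borel_measurable borel" "partial \<xi> h \<in> borel_measurable borel"
    using cont conth by (auto intro: borel_measurable_continuous_onI)
  let ?M = "Pi\<^sub>M (UNIV - {\<xi>}) (\<lambda>_. lborel :: real measure)"
  let ?R = "\<lambda>\<omega>. indicator {\<omega>. \<forall>\<eta>. \<eta> \<noteq> \<xi> \<longrightarrow> \<omega> \<eta> \<in> {l $ \<eta>..u $ \<eta>}} \<omega> :: real"
  have face: "(\<integral>x. h x \<partial>face_measure \<xi> c l u) = (\<integral>\<omega>. ?R \<omega> * h (slice \<xi> c \<omega>) \<partial>?M)"
    "integrable ?M (\<lambda>\<omega>. ?R \<omega> * h (slice \<xi> c \<omega>))" if "c \<in> {l $ \<xi>..u $ \<xi>}" for c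
  proof -
    have ind: "indicator (cbox l u) (slice \<xi> c \<omega>) = ?R \<omega>" for \<omega>
      using that by (auto simp: slice_in_cbox split: split_indicator)
    show "(\<integral>x. h x \<partial>face_measure \<xi> c l u) = (\<integral>\<omega>. ?R \<omega> * h (slice \<xi> c \<omega>) \<partial>?M)"
      unfolding integral_face_measure by (subst integral_plane_measure) (simp_all add: ind)
    obtain K where K: "\<And>x. x \<in> cbox l u \<Longrightarrow> norm (h x) \<le> K"
      using compact_continuous_image[OF continuous_on_subset[OF conth] compact_cbox[of l u]]
      by (meson bounded_iff compact_imp_bounded image_eqI subset_UNIV)
    \<comment> \<open>Integrability on the face: a continuous function is bounded on the compact box, and \<open>?C\<close> has finite measure.\<close>
    let ?C = "Pi\<^sub>E (UNIV - {\<xi>}) (\<lambda>\<eta>. {l $ \<eta>..u $ \<eta>})"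
    have "integrable ?M (\<lambda>\<omega>. indicator (cbox l u) (slice \<xi> c \<omega>) *\<^sub>R h (slice \<xi> c \<omega>))"
    proof (rule integrableI_bounded_set[where A = ?C and B = K])
      show "?C \<in> sets ?M" by (auto intro!: sets_PiM_I_finite)
      have "emeasure ?M ?C = (\<Prod>\<eta>\<in>UNIV - {\<xi>}. emeasure lborel {l $ \<eta>..u $ \<eta>})"
        by (intro lebesgue_line.emeasure_PiM) auto
      also have "\<dots> < \<infinity>"
        using le by (simp add: prod_ennreal)
      finally show "emeasure ?M ?C < \<infinity>" .
      show "AE \<omega> in ?M. \<omega> \<in> ?C \<longrightarrow> norm (indicator (cbox l u) (slice \<xi> c \<omega>) *\<^sub>R h (slice \<xi> c \<omega>)) \<le> K"
      proof (rule AE_I2, rule impI)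
        fix \<omega> assume "\<omega> \<in> ?C"
        then have "slice \<xi> c \<omega> \<in> cbox l u"
          using that by (auto simp: slice_in_cbox PiE_iff)
        then show "norm (indicator (cbox l u) (slice \<xi> c \<omega>) *\<^sub>R h (slice \<xi> c \<omega>)) \<le> K"
          using K by simp
      qed
      show "AE \<omega> in ?M. \<omega> \<notin> ?C \<longrightarrow> indicator (cbox l u) (slice \<xi> c \<omega>) *\<^sub>R h (slice \<xi> c \<omega>) = 0"
        by (rule AE_I2) (auto simp: slice_in_cbox space_PiM PiE_iff indicator_def)
    qed measurable
    then show "integrable ?M (\<lambda>\<omega>. ?R \<omega> * h (slice \<xi> c \<omega>))"
      by (simp add: ind)
  qed
  have int: "integrable lborel (\<lambda>x. indicator (cbox l u) x *\<^sub>R partial \<xi> h x)"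
    by (rule borel_integrable_compact) (auto intro: continuous_on_subset[OF cont])
  have "(\<integral>x. partial \<xi> h x \<partial>lebesgue_on (box l u)) = (\<integral>x. indicator (box l u) x *\<^sub>R partial \<xi> h x \<partial>lborel)"
    by (subst integral_restrict_space) (simp_all add: integral_completion)
  also have "\<dots> = (\<integral>x. indicator (cbox l u) x *\<^sub>R partial \<xi> h x \<partial>lborel)"
    using AE_lborel_cbox_box[of l u] box_subset_cbox[of l u]
    by (intro integral_cong_AE) (auto split: split_indicator elim!: eventually_mono)
  also have "\<dots> = (\<integral>\<omega>. (\<integral>y. indicator (cbox l u) (slice \<xi> y \<omega>) *\<^sub>R partial \<xi> h (slice \<xi> y \<omega>) \<partial>lborel) \<partial>?M)"
    by (rule integral_lborel_slices[OF int])
  also have "\<dots> = (\<integral>\<omega>. ?R \<omega> * h (slice \<xi> (u $ \<xi>) \<omega>) - ?R \<omega> * h (slice \<xi> (l $ \<xi>) \<omega>) \<partial>?M)"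
  proof (rule Bochner_Integration.integral_cong[OF refl])
    fix \<omega>
    have sc: "continuous_on {l $ \<xi>..u $ \<xi>} (\<lambda>y. slice \<xi> y \<omega>)"
      unfolding slice_def
    proof (rule continuous_on_vec_lambda)
      fix \<eta>
      show "continuous_on {l $ \<xi>..u $ \<xi>} (\<lambda>y. if \<eta> = \<xi> then y else \<omega> \<eta>)"
        by (cases "\<eta> = \<xi>") (auto intro: continuous_intros)
    qed
    have "(\<integral>y. indicator (cbox l u) (slice \<xi> y \<omega>) *\<^sub>R partial \<xi> h (slice \<xi> y \<omega>) \<partial>lborel)
        = (\<integral>y. ?R \<omega> * (indicator {l $ \<xi>..u $ \<xi>} y *\<^sub>R partial \<xi> h (slice \<xi> y \<omega>)) \<partial>lborel)"
      by (rule Bochner_Integration.integral_cong[OF refl]) (auto simp: slice_in_cbox split: split_indicator)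
    also have "\<dots> = ?R \<omega> * (\<integral>y. indicator {l $ \<xi>..u $ \<xi>} y *\<^sub>R partial \<xi> h (slice \<xi> y \<omega>) \<partial>lborel)"
      by simp
    also have "(\<integral>y. indicator {l $ \<xi>..u $ \<xi>} y *\<^sub>R partial \<xi> h (slice \<xi> y \<omega>) \<partial>lborel)
        = h (slice \<xi> (u $ \<xi>) \<omega>) - h (slice \<xi> (l $ \<xi>) \<omega>)"
      using le diff sc
      by (intro integral_FTC_atLeastAtMost slice_has_vector_derivative continuous_on_compose2[OF cont]) auto
    finally show "(\<integral>y. indicator (cbox l u) (slice \<xi> y \<omega>) *\<^sub>R partial \<xi> h (slice \<xi> y \<omega>) \<partial>lborel)
        = ?R \<omega> * h (slice \<xi> (u $ \<xi>) \<omega>) - ?R \<omega> * h (slice \<xi> (l $ \<xi>) \<omega>)"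
      by (simp add: right_diff_distrib)
  qed
  also have "\<dots> = (\<integral>x. h x \<partial>face_measure \<xi> (u $ \<xi>) l u) - (\<integral>x. h x \<partial>face_measure \<xi> (l $ \<xi>) l u)"
  proof -
    have m: "u $ \<xi> \<in> {l $ \<xi>..u $ \<xi>}" "l $ \<xi> \<in> {l $ \<xi>..u $ \<xi>}"
      using le by auto
    show ?thesis
      unfolding face(1)[OF m(1)] face(1)[OF m(2)]
      by (rule Bochner_Integration.integral_diff[OF face(2)[OF m(1)] face(2)[OF m(2)]])
  qed
  finally show ?thesis .
qed

text \<open>The symmetry of \<open>B\<close> merges the two terms of the product rule, so the integrand that appears when
the equation is tested with the solution itself is half a derivative.\<close>

lemma partial_quadratic_form:
  fixes B :: "'b :: euclidean_space \<Rightarrow> 'b \<Rightarrow> real"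
  assumes B: "bounded_bilinear B" and sym: "\<And>p q. B p q = B q p" and f: "C1 f"
  shows "C1 (\<lambda>x. B (f x) (f x))" "partial \<xi> (\<lambda>x. B (f x) (f x)) x = 2 * B (f x) (partial \<xi> f x)"
proof -
  have der: "((\<lambda>x. B (f x) (f x)) has_derivative
      (\<lambda>h. B (f x) (frechet_derivative f (at x) h) + B (frechet_derivative f (at x) h) (f x))) (at x)" for x
    using f by (intro bounded_bilinear.FDERIV[OF B]) (auto simp: C1_def frechet_derivative_works[symmetric])
  have part: "partial \<xi> (\<lambda>x. B (f x) (f x)) = (\<lambda>x. 2 * B (f x) (partial \<xi> f x))" for \<xi>
    using frechet_derivative_at[OF der] by (auto simp: partial_def fun_eq_iff sym dest: sym[THEN subst])
  then show "partial \<xi> (\<lambda>x. B (f x) (f x)) x = 2 * B (f x) (partial \<xi> f x)"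
    by simp
  have "continuous_on UNIV (\<lambda>x. 2 * B (f x) (partial \<xi> f x))" for \<xi>
    using f C1_continuous[OF f]
    by (intro continuous_on_mult continuous_on_const bounded_bilinear.continuous_on[OF B]) (auto simp: C1_def)
  then show "C1 (\<lambda>x. B (f x) (f x))"
    unfolding C1_def part using der by (auto simp: differentiable_def)
qed

text \<open>Both sides are continuous along a sequence of \<open>C\<^sup>1\<close> functions that defines the trace: the left side
under \<open>L\<^sup>2\<close> convergence of the functions and their gradients in the box, the right side under
\<open>L\<^sup>2\<close> convergence on the faces.\<close>

proposition Gauss_Green_box_H1:
  fixes B :: "'b :: euclidean_space \<Rightarrow> 'b \<Rightarrow> real"
  assumes B: "bounded_bilinear B" and sym: "\<And>p q. B p q = B q p"
    and tr: "has_trace l u f g \<tau>" and le: "\<And>\<eta>. l $ \<eta> \<le> u $ \<eta>"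
  shows "2 * (\<integral>x. B (f x) (g \<xi> x) \<partial>lebesgue_on (box l u))
    = (\<integral>x. B (\<tau> x) (\<tau> x) \<partial>face_measure \<xi> (u $ \<xi>) l u) - (\<integral>x. B (\<tau> x) (\<tau> x) \<partial>face_measure \<xi> (l $ \<xi>) l u)"
proof -
  obtain \<phi> where C1: "\<And>n. C1 (\<phi> n)"
    and f: "L2_tendsto (lebesgue_on (box l u)) \<phi> f"
    and g: "L2_tendsto (lebesgue_on (box l u)) (\<lambda>n. partial \<xi> (\<phi> n)) (g \<xi>)"
    and \<tau>: "\<And>c. c \<in> {l $ \<xi>, u $ \<xi>} \<Longrightarrow> L2_tendsto (face_measure \<xi> c l u) \<phi> \<tau>"
    using tr unfolding has_trace_def by blast
  have "2 * (\<integral>x. B (\<phi> n x) (partial \<xi> (\<phi> n) x) \<partial>lebesgue_on (box l u))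
      = (\<integral>x. B (\<phi> n x) (\<phi> n x) \<partial>face_measure \<xi> (u $ \<xi>) l u)
        - (\<integral>x. B (\<phi> n x) (\<phi> n x) \<partial>face_measure \<xi> (l $ \<xi>) l u)" for n
    using Gauss_Green_box_C1[OF partial_quadratic_form(1)[OF B sym C1[of n]] le, of \<xi>]
    by (simp add: partial_quadratic_form(2)[OF B sym C1])
  moreover have "(\<lambda>n. 2 * (\<integral>x. B (\<phi> n x) (partial \<xi> (\<phi> n) x) \<partial>lebesgue_on (box l u)))
      \<longlonglongrightarrow> 2 * (\<integral>x. B (f x) (g \<xi> x) \<partial>lebesgue_on (box l u))"
    by (intro tendsto_intros L2_tendsto_integral_bilinear[OF B] f g)
  moreover have "(\<lambda>n. (\<integral>x. B (\<phi> n x) (\<phi> n x) \<partial>face_measure \<xi> (u $ \<xi>) l u)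
        - (\<integral>x. B (\<phi> n x) (\<phi> n x) \<partial>face_measure \<xi> (l $ \<xi>) l u))
      \<longlonglongrightarrow> (\<integral>x. B (\<tau> x) (\<tau> x) \<partial>face_measure \<xi> (u $ \<xi>) l u) - (\<integral>x. B (\<tau> x) (\<tau> x) \<partial>face_measure \<xi> (l $ \<xi>) l u)"
    by (intro tendsto_intros L2_tendsto_integral_bilinear[OF B] \<tau>) auto
  ultimately show ?thesis
    by (simp add: LIMSEQ_unique)
qed

section \<open>Integrals over the cells of a grid\<close>

text \<open>Since Lebesgue measure is complete, measurability of \<open>g\<close> is a consequence.  The weighted energy
density involves \<open>matrix_inv\<close> of a variable matrix; through this lemma its measurability
and integrability come from the equation.\<close>

lemma lebesgue_on_cong_AE:
  fixes f g :: "'a :: euclidean_space \<Rightarrow> 'b :: euclidean_space"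
  assumes S: "S \<in> sets lebesgue" and f: "integrable (lebesgue_on S) f"
    and ae: "AE x in lebesgue_on S. f x = g x"
  shows "integrable (lebesgue_on S) g" "(\<integral>x. g x \<partial>lebesgue_on S) = (\<integral>x. f x \<partial>lebesgue_on S)"
proof -
  let ?f = "\<lambda>x. indicator S x *\<^sub>R f x" and ?g = "\<lambda>x. indicator S x *\<^sub>R g x"
  have f': "integrable lebesgue ?f"
    using S f by (subst (asm) integrable_restrict_space) auto
  have "AE x in lebesgue. x \<in> S \<longrightarrow> f x = g x"
    using S ae by (subst (asm) AE_restrict_space_iff) auto
  then have ae': "AE x in lebesgue. ?f x = ?g x"
    by eventually_elim (auto simp: indicator_def)
  have meas: "?f \<in> borel_measurable lebesgue" "?g \<in> borel_measurable lebesgue"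
    using borel_measurable_integrable[OF f'] borel_measurable_AE[OF _ ae'] by auto
  show "integrable (lebesgue_on S) g"
    using integrable_cong_AE[OF meas ae'] f' S by (subst integrable_restrict_space) auto
  show "(\<integral>x. g x \<partial>lebesgue_on S) = (\<integral>x. f x \<partial>lebesgue_on S)"
    using integral_cong_AE[OF meas ae'] S by (simp add: integral_restrict_space)
qed

lemma L2_lebesgue_on_subset:
  assumes f: "L2 (lebesgue_on S) f" and T: "T \<in> sets lebesgue" and S: "S \<in> sets lebesgue" and "T \<subseteq> S"
  shows "L2 (lebesgue_on T) f"
  unfolding L2_def
proof
  show "f \<in> borel_measurable (lebesgue_on T)"
    using f \<open>T \<subseteq> S\<close> by (auto simp: L2_def intro: measurable_restrict_mono)
  have "set_integrable lebesgue S (\<lambda>x. (norm (f x))\<^sup>2)"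
    using f S by (auto simp: L2_def set_integrable_def integrable_restrict_space)
  then have "set_integrable lebesgue T (\<lambda>x. (norm (f x))\<^sup>2)"
    using T \<open>T \<subseteq> S\<close> by (rule set_integrable_subset)
  then show "integrable (lebesgue_on T) (\<lambda>x. (norm (f x))\<^sup>2)"
    using T by (simp add: set_integrable_def integrable_restrict_space)
qed

lemma grid_less: "is_grid n t \<Longrightarrow> j < k \<Longrightarrow> k \<le> n \<xi> \<Longrightarrow> t \<xi> j < t \<xi> k"
  unfolding is_grid_def by (auto simp: strict_mono_on_def)

lemma grid_le: "is_grid n t \<Longrightarrow> j \<le> k \<Longrightarrow> k \<le> n \<xi> \<Longrightarrow> t \<xi> j \<le> t \<xi> k"
  using grid_less[of n t j k \<xi>] by (cases "j = k") auto

lemma grid_ends: "is_grid n t \<Longrightarrow> t \<xi> 0 = - 1" "is_grid n t \<Longrightarrow> t \<xi> (n \<xi>) = 1"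
  by (auto simp: is_grid_def)

lemma grid_pos: "is_grid n t \<Longrightarrow> 0 < n \<xi>"
  using grid_ends[of n t \<xi>] by (cases "n \<xi> = 0") auto

lemma finite_cells: "finite (cells n)"
proof -
  have "cells n = Pi\<^sub>E UNIV (\<lambda>\<xi>. {..<n \<xi>})"
    by (auto simp: cells_def PiE_iff)
  then show ?thesis by (simp add: finite_PiE)
qed

lemma mem_\<Omega>: "x \<in> \<Omega> \<longleftrightarrow> (\<forall>\<xi>. - 1 \<le> x $ \<xi> \<and> x $ \<xi> \<le> 1)"
  by (auto simp: \<Omega>_def mem_box_cart)

lemma mem_cell_cbox: "x \<in> cbox (lower t i) (upper t i) \<longleftrightarrow> (\<forall>\<xi>. t \<xi> (i \<xi>) \<le> x $ \<xi> \<and> x $ \<xi> \<le> t \<xi> (Suc (i \<xi>)))"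
  by (auto simp: mem_box_cart lower_def upper_def)

lemma mem_cell_box: "x \<in> box (lower t i) (upper t i) \<longleftrightarrow> (\<forall>\<xi>. t \<xi> (i \<xi>) < x $ \<xi> \<and> x $ \<xi> < t \<xi> (Suc (i \<xi>)))"
  by (auto simp: mem_box_cart lower_def upper_def)

lemma cell_subset_\<Omega>:
  assumes "is_grid n t" "i \<in> cells n"
  shows "cbox (lower t i) (upper t i) \<subseteq> \<Omega>"
proof
  fix x assume x: "x \<in> cbox (lower t i) (upper t i)"
  have "- 1 \<le> t \<xi> (i \<xi>)" "t \<xi> (Suc (i \<xi>)) \<le> 1" for \<xi>
    using grid_le[OF assms(1), of 0 "i \<xi>" \<xi>] grid_le[OF assms(1), of "Suc (i \<xi>)" "n \<xi>" \<xi>]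
      grid_ends[OF assms(1)] assms(2) by (auto simp: cells_def Suc_le_eq less_imp_le)
  then show "x \<in> \<Omega>"
    using x unfolding mem_\<Omega> mem_cell_cbox by (meson order_trans)
qed

lemma cell_at_eqI:
  assumes "is_grid n t" "k < n \<xi>" "t \<xi> k < x $ \<xi>" "x $ \<xi> \<le> t \<xi> (Suc k)"
  shows "cell_at t x \<xi> = k"
  unfolding cell_at_def
proof (rule Least_equality)
  fix j assume j: "x $ \<xi> \<le> t \<xi> (Suc j)"
  show "k \<le> j"
  proof (rule ccontr)
    assume "\<not> k \<le> j"
    then have "t \<xi> (Suc j) \<le> t \<xi> k"
      using assms by (intro grid_le[of n]) auto
    with j assms show False by simp
  qed
qed fact

lemma cell_at_lower_face:
  assumes "is_grid n t" "x $ \<xi> = - 1"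
  shows "cell_at t x \<xi> = 0"
  unfolding cell_at_def
proof (rule Least_equality)
  show "x $ \<xi> \<le> t \<xi> (Suc 0)"
    using assms grid_less[OF assms(1), of 0 "Suc 0" \<xi>] grid_pos[OF assms(1), of \<xi>] grid_ends[OF assms(1)]
    by auto
qed simp

lemma cell_at_upper_face:
  assumes "is_grid n t" "x $ \<xi> = 1"
  shows "cell_at t x \<xi> = n \<xi> - 1"
  using assms grid_pos[OF assms(1), of \<xi>] grid_less[OF assms(1), of "n \<xi> - 1" "n \<xi>" \<xi>] grid_ends[OF assms(1)]
  by (intro cell_at_eqI[OF assms(1)]) auto

lemma cell_at_mem:
  assumes g: "is_grid n t" and x: "x \<in> \<Omega>"
  shows "cell_at t x \<in> cells n" "x \<in> cbox (lower t (cell_at t x)) (upper t (cell_at t x))"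
proof -
  have *: "cell_at t x \<xi> < n \<xi> \<and> t \<xi> (cell_at t x \<xi>) \<le> x $ \<xi> \<and> x $ \<xi> \<le> t \<xi> (Suc (cell_at t x \<xi>))" for \<xi>
  proof -
    have last: "x $ \<xi> \<le> t \<xi> (Suc (n \<xi> - 1))"
      using x grid_pos[OF g, of \<xi>] grid_ends[OF g, of \<xi>] by (simp add: mem_\<Omega>)
    then have le: "cell_at t x \<xi> \<le> n \<xi> - 1"
      unfolding cell_at_def by (rule Least_le)
    have up: "x $ \<xi> \<le> t \<xi> (Suc (cell_at t x \<xi>))"
      unfolding cell_at_def using last by (rule LeastI)
    have "t \<xi> (cell_at t x \<xi>) \<le> x $ \<xi>"
    proof (cases "cell_at t x \<xi>")
      case 0
      then show ?thesis using x grid_ends[OF g, of \<xi>] by (simp add: mem_\<Omega>)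
    next
      case (Suc k)
      then have "\<not> x $ \<xi> \<le> t \<xi> (Suc k)"
        using not_less_Least[of k "\<lambda>k. x $ \<xi> \<le> t \<xi> (Suc k)"] by (simp add: cell_at_def)
      then show ?thesis using Suc by simp
    qed
    with le up show ?thesis using grid_pos[OF g, of \<xi>] by linarith
  qed
  then show "cell_at t x \<in> cells n" "x \<in> cbox (lower t (cell_at t x)) (upper t (cell_at t x))"
    unfolding mem_cell_cbox by (simp_all add: cells_def)
qed

lemma cell_at_unique:
  assumes "is_grid n t" "i \<in> cells n" "x \<in> cbox (lower t i) (upper t i)" "x $ \<eta> \<noteq> t \<eta> (i \<eta>)"
  shows "cell_at t x \<eta> = i \<eta>"
  using assms by (intro cell_at_eqI[OF assms(1)]) (auto simp: mem_cell_cbox cells_def less_le)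

lemma cell_at_measurable [measurable]:
  "(\<lambda>x. cell_at t x \<xi>) \<in> measurable borel (count_space UNIV)"
  unfolding cell_at_def by measurable

text \<open>Away from these null sets each point of the domain lies in the interior of exactly one cell.\<close>

lemma AE_off_grid_planes:
  fixes n :: "3 \<Rightarrow> nat"
  shows "AE x in lebesgue. \<forall>\<eta>. \<forall>k\<in>{..n \<eta>}. (x :: real ^ 3) $ \<eta> \<noteq> t \<eta> k"
proof (intro AE_all_countable[THEN iffD2] allI AE_ball_countable[THEN iffD2] ballI)
  fix \<eta> :: 3 and k
  have "{x. x $ \<eta> = t \<eta> k} \<in> null_sets lebesgue"
    using negligible_hyperplane[of "axis \<eta> 1 :: real ^ 3" "t \<eta> k"]
    by (simp add: negligible_iff_null_sets inner_axis' axis_eq_0_iff)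
  then show "AE x in lebesgue. x $ \<eta> \<noteq> t \<eta> k"
    by (rule AE_I') auto
qed (auto intro: countable_finite)

lemma integral_sum_cells:
  fixes g :: "real ^ 3 \<Rightarrow> 'b :: euclidean_space"
  assumes grid: "is_grid n t"
    and g: "\<And>i. i \<in> cells n \<Longrightarrow> integrable (lebesgue_on (box (lower t i) (upper t i))) g"
  shows "integrable (lebesgue_on \<Omega>) g"
    "(\<integral>x. g x \<partial>lebesgue_on \<Omega>) = (\<Sum>i\<in>cells n. \<integral>x. g x \<partial>lebesgue_on (box (lower t i) (upper t i)))"
proof -
  let ?b = "\<lambda>i. box (lower t i) (upper t i)"
  let ?U = "\<Union>i\<in>cells n. ?b i"
  have sets: "?b i \<in> sets lebesgue" "?U \<in> sets lebesgue" "\<Omega> \<in> sets lebesgue" for i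
    by (auto intro!: sets.finite_UN finite_cells simp: \<Omega>_def)
  have int: "set_integrable lebesgue (?b i) g" if "i \<in> cells n" for i
    using g[OF that] by (simp add: set_integrable_def integrable_restrict_space)
  have "set_integrable lebesgue ?U g"
    using int sets by (intro set_integrable_UN finite_cells)
  then have intU: "integrable lebesgue (\<lambda>x. indicator ?U x *\<^sub>R g x)"
    by (simp add: set_integrable_def)
  have "AE x in lebesgue. x \<in> ?U \<longleftrightarrow> x \<in> \<Omega>"
    using AE_off_grid_planes[of n t]
  proof eventually_elim
    case (elim x)
    show ?case
    proof
      assume "x \<in> ?U"
      then show "x \<in> \<Omega>"
        using cell_subset_\<Omega>[OF grid] box_subset_cbox by blast
    next
      assume x: "x \<in> \<Omega>"
      let ?i = "cell_at t x"
      have i: "?i \<in> cells n" "x \<in> cbox (lower t ?i) (upper t ?i)"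
        using cell_at_mem[OF grid x] by auto
      then have "x $ \<eta> \<noteq> t \<eta> (?i \<eta>)" "x $ \<eta> \<noteq> t \<eta> (Suc (?i \<eta>))" for \<eta>
        using elim by (auto simp: cells_def less_imp_le Suc_le_eq)
      with i have "x \<in> ?b ?i"
        unfolding mem_cell_box mem_cell_cbox by (metis order_le_less)
      with i show "x \<in> ?U" by blast
    qed
  qed
  then have ae: "AE x in lebesgue. indicator ?U x *\<^sub>R g x = indicator \<Omega> x *\<^sub>R g x"
    by eventually_elim (auto simp: indicator_def)
  have meas: "(\<lambda>x. indicator ?U x *\<^sub>R g x) \<in> borel_measurable lebesgue"
      "(\<lambda>x. indicator \<Omega> x *\<^sub>R g x) \<in> borel_measurable lebesgue"
    using borel_measurable_integrable[OF intU] borel_measurable_AE[OF _ ae] by auto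
  show "integrable (lebesgue_on \<Omega>) g"
    using integrable_cong_AE[OF meas ae] intU sets by (simp add: integrable_restrict_space)
  have "disjoint": "AE x in lebesgue. x \<in> ?b i \<and> x \<in> ?b j \<longrightarrow> i = j" if "i \<in> cells n" "j \<in> cells n" for i j
  proof (rule AE_I2, safe)
    fix x assume x: "x \<in> ?b i" "x \<in> ?b j"
    have "cell_at t x \<eta> = i \<eta>" if "i \<in> cells n" "x \<in> ?b i" for i \<eta>
    proof (rule cell_at_unique[OF grid that(1)])
      show "x \<in> cbox (lower t i) (upper t i)"
        using that(2) box_subset_cbox by blast
      show "x $ \<eta> \<noteq> t \<eta> (i \<eta>)"
        using that(2) unfolding mem_cell_box by (metis order_less_irrefl)
    qed
    from this[OF that(1) x(1)] this[OF that(2) x(2)]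
    show "i = j" by (simp add: fun_eq_iff)
  qed
  have "(\<integral>x. g x \<partial>lebesgue_on \<Omega>) = (LINT x:?U|lebesgue. g x)"
    using integral_cong_AE[OF meas ae] sets
    by (simp add: integral_restrict_space set_lebesgue_integral_def)
  also have "\<dots> = (\<Sum>i\<in>cells n. LINT x:?b i|lebesgue. g x)"
    using int sets "disjoint" by (intro set_integral_finite_UN_AE finite_cells)
  also have "\<dots> = (\<Sum>i\<in>cells n. \<integral>x. g x \<partial>lebesgue_on (?b i))"
    by (simp add: integral_restrict_space set_lebesgue_integral_def)
  finally show "(\<integral>x. g x \<partial>lebesgue_on \<Omega>) = (\<Sum>i\<in>cells n. \<integral>x. g x \<partial>lebesgue_on (?b i))" .
qed

lemma borel_measurable_face_measure:
  fixes f :: "real ^ 3 \<Rightarrow> real"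
  shows "f \<in> borel_measurable (face_measure \<xi> c l u)
    \<longleftrightarrow> (\<lambda>x. indicator (cbox l u) x *\<^sub>R f x) \<in> borel_measurable borel"
  unfolding face_measure_def
  by (subst borel_measurable_restrict_space_iff) (auto cong: measurable_cong_sets)

text \<open>A function that is glued from the cells by \<open>cell_at\<close> is integrated over an outer face one cell at
a time.  The hypothesis on \<open>f\<close> asks for Borel measurability on every cell, also
on cells away from the face, because \<open>plane_measure\<close> lives on the Borel sets of the whole space.\<close>

lemma integral_outer_face:
  fixes f :: "(3 \<Rightarrow> nat) \<Rightarrow> real ^ 3 \<Rightarrow> real"
  assumes grid: "is_grid n t"
    and f: "\<And>i. i \<in> cells n \<Longrightarrow> (\<lambda>x. indicator (cbox (lower t i) (upper t i)) x *\<^sub>R f i x) \<in> borel_measurable borel"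
    and int: "\<And>i. i \<in> cells n \<Longrightarrow> i \<xi> = k \<Longrightarrow> integrable (face_measure \<xi> c (lower t i) (upper t i)) (f i)"
    and k: "\<And>x. x $ \<xi> = c \<Longrightarrow> cell_at t x \<xi> = k"
  shows "(\<integral>x. f (cell_at t x) x \<partial>\<Omega>_face \<xi> c)
    = (\<Sum>i\<in>{i \<in> cells n. i \<xi> = k}. \<integral>x. f i x \<partial>face_measure \<xi> c (lower t i) (upper t i))"
proof -
  let ?g = "\<lambda>i x. indicator (cbox (lower t i) (upper t i)) x *\<^sub>R f i x"
  let ?K = "{i \<in> cells n. i \<xi> = k}"
  \<comment> \<open>For measurability, decompose exactly into the fibres of \<open>cell_at\<close>, which are Borel sets.\<close>
  have "(\<lambda>x. indicator \<Omega> x *\<^sub>R f (cell_at t x) x)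
      = (\<lambda>x. \<Sum>i\<in>cells n. indicator {x \<in> \<Omega>. cell_at t x = i} x * ?g i x)"
  proof
    fix x
    show "indicator \<Omega> x *\<^sub>R f (cell_at t x) x
      = (\<Sum>i\<in>cells n. indicator {x \<in> \<Omega>. cell_at t x = i} x * ?g i x)"
    proof (cases "x \<in> \<Omega>")
      case True
      have "(\<Sum>i\<in>cells n. indicator {x \<in> \<Omega>. cell_at t x = i} x * ?g i x)
          = (\<Sum>i\<in>cells n. if i = cell_at t x then f i x else 0)"
        using True cell_at_mem(2)[OF grid True] by (intro sum.cong) (auto simp: indicator_def)
      then show ?thesis
        using True cell_at_mem(1)[OF grid True] finite_cells[of n] by simp
    qed simp
  qed
  also have "\<dots> \<in> borel_measurable borel"
  proof (intro borel_measurable_sum borel_measurable_times f borel_measurable_indicator)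
    show "{x \<in> \<Omega>. cell_at t x = i} \<in> sets borel" for i
      unfolding \<Omega>_def fun_eq_iff by measurable
  qed
  finally have meas: "(\<lambda>x. indicator \<Omega> x *\<^sub>R f (cell_at t x) x) \<in> borel_measurable borel" .
  \<comment> \<open>For the value, points whose tangential coordinates avoid the grid lie in one cell of the layer \<open>i \<xi> = k\<close> only.\<close>
  have "AE x in plane_measure \<xi> c. \<forall>\<eta>. \<forall>j\<in>{..n \<eta>}. \<eta> \<noteq> \<xi> \<longrightarrow> x $ \<eta> \<noteq> t \<eta> j"
  proof (intro AE_all_countable[THEN iffD2] allI AE_ball_countable[THEN iffD2] ballI)
    fix \<eta> :: 3 and j
    show "AE x in plane_measure \<xi> c. \<eta> \<noteq> \<xi> \<longrightarrow> x $ \<eta> \<noteq> t \<eta> j"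
      using AE_plane_measure_coordinate_neq[of \<eta> \<xi> "t \<eta> j" c] by (cases "\<eta> = \<xi>") auto
  qed auto
  then have ae: "AE x in plane_measure \<xi> c. indicator \<Omega> x *\<^sub>R f (cell_at t x) x = (\<Sum>i\<in>?K. ?g i x)"
    using AE_plane_measure_coordinate[of \<xi> c]
  proof eventually_elim
    case (elim x)
    show ?case
    proof (cases "x \<in> \<Omega>")
      case True
      have i: "cell_at t x \<in> ?K"
        using cell_at_mem(1)[OF grid True] k[OF elim(2)] by simp
      have uniq: "i = cell_at t x" if i: "i \<in> ?K" "x \<in> cbox (lower t i) (upper t i)" for i
      proof
        fix \<eta>
        show "i \<eta> = cell_at t x \<eta>"
        proof (cases "\<eta> = \<xi>")
          case False
          then have "x $ \<eta> \<noteq> t \<eta> (i \<eta>)"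
            using elim(1) i by (auto simp: cells_def less_imp_le)
          then show ?thesis
            using i by (intro cell_at_unique[OF grid, symmetric]) auto
        qed (use i k[OF elim(2)] in simp)
      qed
      have "(\<Sum>i\<in>?K. ?g i x) = (\<Sum>i\<in>?K. if i = cell_at t x then f i x else 0)"
      proof (intro sum.cong refl)
        fix i assume "i \<in> ?K"
        show "?g i x = (if i = cell_at t x then f i x else 0)"
        proof (cases "i = cell_at t x")
          case True
          with cell_at_mem(2)[OF grid \<open>x \<in> \<Omega>\<close>] show ?thesis by simp
        next
          case False
          with uniq[OF \<open>i \<in> ?K\<close>] have "x \<notin> cbox (lower t i) (upper t i)" by metis
          with False show ?thesis by simp
        qed
      qed
      then show ?thesis
        using True i finite_cells[of n] by simp
    next
      case False
      then have "(\<Sum>i\<in>?K. ?g i x) = 0"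
        using cell_subset_\<Omega>[OF grid] by (intro sum.neutral) (auto simp: indicator_def)
      with False show ?thesis by simp
    qed
  qed
  have "(\<integral>x. f (cell_at t x) x \<partial>\<Omega>_face \<xi> c) = (\<integral>x. indicator \<Omega> x *\<^sub>R f (cell_at t x) x \<partial>plane_measure \<xi> c)"
    by (simp add: integral_face_measure \<Omega>_def)
  also have "\<dots> = (\<integral>x. (\<Sum>i\<in>?K. ?g i x) \<partial>plane_measure \<xi> c)"
    using meas f by (intro integral_cong_AE ae borel_measurable_sum) (auto cong: measurable_cong_sets)
  also have "\<dots> = (\<Sum>i\<in>?K. \<integral>x. ?g i x \<partial>plane_measure \<xi> c)"
    using int by (intro Bochner_Integration.integral_sum) (auto simp: integrable_face_measure)
  finally show ?thesis by (simp add: integral_face_measure)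
qed

text \<open>The face measures of the two cells live on different boxes, but these boxes have the same section
with the common plane, which carries all of the mass of \<open>plane_measure\<close>.\<close>

lemma integral_shared_face:
  fixes f g :: "real ^ 3 \<Rightarrow> real"
  assumes grid: "is_grid n t" and i: "i \<in> cells n" and j: "j \<in> cells n" "j = i(\<xi> := Suc (i \<xi>))"
    and f: "(\<lambda>x. indicator (cbox (lower t i) (upper t i)) x *\<^sub>R f x) \<in> borel_measurable borel"
    and g: "(\<lambda>x. indicator (cbox (lower t j) (upper t j)) x *\<^sub>R g x) \<in> borel_measurable borel"
    and eq: "AE x in face_measure \<xi> (t \<xi> (Suc (i \<xi>))) (lower t i) (upper t i). f x = g x"
  shows "(\<integral>x. f x \<partial>face_measure \<xi> (t \<xi> (Suc (i \<xi>))) (lower t i) (upper t i))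
    = (\<integral>x. g x \<partial>face_measure \<xi> (t \<xi> (Suc (i \<xi>))) (lower t j) (upper t j))"
proof -
  have "Suc (i \<xi>) < n \<xi>"
    using j by (auto simp: cells_def dest: spec[of _ \<xi>])
  then have le: "t \<xi> (i \<xi>) \<le> t \<xi> (Suc (i \<xi>))" "t \<xi> (Suc (i \<xi>)) \<le> t \<xi> (Suc (Suc (i \<xi>)))"
    by (auto intro!: grid_le[OF grid])
  have same: "x \<in> cbox (lower t i) (upper t i) \<longleftrightarrow> x \<in> cbox (lower t j) (upper t j)"
    if "x $ \<xi> = t \<xi> (Suc (i \<xi>))" for x
    using that le unfolding mem_cell_cbox j(2) by (metis fun_upd_apply order_refl)
  have "AE x in plane_measure \<xi> (t \<xi> (Suc (i \<xi>))). indicator (cbox (lower t i) (upper t i)) x *\<^sub>R f x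
      = indicator (cbox (lower t j) (upper t j)) x *\<^sub>R g x"
    using eq[unfolded AE_face_measure] AE_plane_measure_coordinate
    by eventually_elim (auto simp: indicator_def same)
  then show ?thesis
    unfolding integral_face_measure using f g
    by (intro integral_cong_AE) (auto cong: measurable_cong_sets)
qed

text \<open>Shifting the index by one cell in direction \<open>\<xi>\<close> matches every upper face that is not in the last
layer with a lower face that is not in the first layer.\<close>

lemma sum_cells_telescope:
  fixes U L :: "(3 \<Rightarrow> nat) \<Rightarrow> real"
  assumes pos: "0 < n \<xi>"
    and UL: "\<And>i j. i \<in> cells n \<Longrightarrow> j \<in> cells n \<Longrightarrow> j = i(\<xi> := Suc (i \<xi>)) \<Longrightarrow> U i = L j"
  shows "(\<Sum>i\<in>cells n. U i - L i)
    = (\<Sum>i\<in>{i \<in> cells n. i \<xi> = n \<xi> - 1}. U i) - (\<Sum>i\<in>{i \<in> cells n. i \<xi> = 0}. L i)"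
proof -
  have fin: "finite {i \<in> cells n. R i}" for R
    using finite_cells by simp
  have "(\<Sum>i\<in>cells n. U i) = (\<Sum>i\<in>{i \<in> cells n. i \<xi> = n \<xi> - 1}. U i) + (\<Sum>i\<in>{i \<in> cells n. i \<xi> \<noteq> n \<xi> - 1}. U i)"
    by (subst sum.union_disjoint[symmetric]) (auto intro!: sum.cong fin)
  moreover have "(\<Sum>i\<in>cells n. L i) = (\<Sum>i\<in>{i \<in> cells n. i \<xi> = 0}. L i) + (\<Sum>i\<in>{i \<in> cells n. i \<xi> \<noteq> 0}. L i)"
    by (subst sum.union_disjoint[symmetric]) (auto intro!: sum.cong fin)
  moreover have "(\<Sum>i\<in>{i \<in> cells n. i \<xi> \<noteq> n \<xi> - 1}. U i) = (\<Sum>i\<in>{i \<in> cells n. i \<xi> \<noteq> 0}. L i)"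
  proof (rule sum.reindex_bij_witness[where i = "\<lambda>i. i(\<xi> := i \<xi> - 1)" and j = "\<lambda>i. i(\<xi> := Suc (i \<xi>))"])
    fix i assume i: "i \<in> {i \<in> cells n. i \<xi> \<noteq> n \<xi> - 1}"
    then have "Suc (i \<xi>) < n \<xi>"
      by (auto simp: cells_def dest: spec[of _ \<xi>])
    with i show j: "i(\<xi> := Suc (i \<xi>)) \<in> {i \<in> cells n. i \<xi> \<noteq> 0}"
      by (auto simp: cells_def)
    with i show "L (i(\<xi> := Suc (i \<xi>))) = U i"
      by (intro UL[symmetric]) auto
  next
    fix i assume i: "i \<in> {i \<in> cells n. i \<xi> \<noteq> 0}"
    then have "i \<xi> < n \<xi>" by (simp add: cells_def)
    then have "i \<xi> - 1 < n \<xi>" "i \<xi> - 1 \<noteq> n \<xi> - 1"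
      using i by auto
    with i show "i(\<xi> := i \<xi> - 1) \<in> {i \<in> cells n. i \<xi> \<noteq> n \<xi> - 1}"
      by (auto simp: cells_def)
  qed auto
  ultimately show ?thesis
    by (simp add: sum_subtractf)
qed

section \<open>Flux balance of piecewise \<open>H\<^sup>1\<close> states\<close>

lemma boundary_term_flux_form:
  "boundary_term q = (\<Sum>\<xi>\<in>UNIV. ((\<integral>x. flux_form \<xi> (q x) (q x) \<partial>\<Omega>_face \<xi> 1)
     - (\<integral>x. flux_form \<xi> (q x) (q x) \<partial>\<Omega>_face \<xi> (- 1))) / 2)"
  unfolding boundary_term_def flux_form_def by (simp add: diff_divide_distrib)

text \<open>Gauss-Green in each cell gives the flux through its six faces.  The fluxes through a common face of
two cells cancel, since traction and velocity are continuous there and determine the flux, and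
only the outer boundary remains.\<close>

proposition piecewise_H1_flux_balance:
  fixes Q :: "real ^ 3 \<Rightarrow> state"
  assumes grid: "is_grid n t"
    and tr: "\<And>i. i \<in> cells n \<Longrightarrow> has_trace (lower t i) (upper t i) Q DQ (tr i)"
    and interface: "\<And>i j \<xi>. i \<in> cells n \<Longrightarrow> j \<in> cells n \<Longrightarrow> j = i(\<xi> := Suc (i \<xi>)) \<Longrightarrow>
         AE x in face_measure \<xi> (t \<xi> (Suc (i \<xi>))) (lower t i) (upper t i).
           traction \<xi> (tr j x) = traction \<xi> (tr i x) \<and> velocity (tr j x) - velocity (tr i x) = 0"
  shows "(\<Sum>i\<in>cells n. \<Sum>\<xi>\<in>UNIV. \<integral>x. flux_form \<xi> (Q x) (DQ \<xi> x) \<partial>lebesgue_on (box (lower t i) (upper t i)))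
    = boundary_term (outer_trace t tr)"
proof -
  let ?f = "\<lambda>\<xi> i x. flux_form \<xi> (tr i x) (tr i x)"
  let ?face = "\<lambda>\<xi> c i. face_measure \<xi> c (lower t i) (upper t i)"
  define U where "U \<xi> i = (\<integral>x. ?f \<xi> i x \<partial>?face \<xi> (t \<xi> (Suc (i \<xi>))) i)" for \<xi> i
  define L where "L \<xi> i = (\<integral>x. ?f \<xi> i x \<partial>?face \<xi> (t \<xi> (i \<xi>)) i)" for \<xi> i
  have L2: "L2 (?face \<xi> c i) (tr i)" if "i \<in> cells n" "c = t \<xi> (i \<xi>) \<or> c = t \<xi> (Suc (i \<xi>))" for i c \<xi>
  proof -
    have "c \<in> {lower t i $ \<xi>, upper t i $ \<xi>}"
      using that(2) by (auto simp: lower_def upper_def)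
    with tr[OF that(1)] show ?thesis
      unfolding has_trace_def L2_tendsto_def by blast
  qed
  have int: "integrable (?face \<xi> c i) (?f \<xi> i)" if "i \<in> cells n" "c = t \<xi> (i \<xi>) \<or> c = t \<xi> (Suc (i \<xi>))" for i c \<xi>
    using L2_integrable_bilinear[OF bounded_bilinear_flux_form L2[OF that] L2[OF that]] .
  have meas: "(\<lambda>x. indicator (cbox (lower t i) (upper t i)) x *\<^sub>R ?f \<xi> i x) \<in> borel_measurable borel"
    if "i \<in> cells n" for i \<xi>
    using borel_measurable_integrable[OF int[OF that]] unfolding borel_measurable_face_measure by blast
  have balance: "2 * (\<integral>x. flux_form \<xi> (Q x) (DQ \<xi> x) \<partial>lebesgue_on (box (lower t i) (upper t i))) = U \<xi> i - L \<xi> i"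
    if i: "i \<in> cells n" for i \<xi>
  proof -
    have "lower t i $ \<eta> \<le> upper t i $ \<eta>" for \<eta>
      using i by (auto simp: lower_def upper_def cells_def Suc_le_eq intro!: grid_le[OF grid])
    from Gauss_Green_box_H1[OF bounded_bilinear_flux_form flux_form_commute tr[OF i] this, of \<xi> \<xi>]
    show ?thesis by (simp add: U_def L_def lower_def upper_def)
  qed
  have shared: "U \<xi> i = L \<xi> j" if i: "i \<in> cells n" and j: "j \<in> cells n" "j = i(\<xi> := Suc (i \<xi>))" for i j \<xi>
  proof -
    have "AE x in ?face \<xi> (t \<xi> (Suc (i \<xi>))) i. ?f \<xi> i x = ?f \<xi> j x"
      using interface[OF i j] by eventually_elim (simp add: flux_form_velocity_traction)
    from integral_shared_face[OF grid i j meas[OF i] meas[OF j(1)] this] show ?thesis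
      using j(2) by (simp add: U_def L_def)
  qed
  have outer: "(\<Sum>i\<in>cells n. U \<xi> i - L \<xi> i)
      = (\<integral>x. flux_form \<xi> (outer_trace t tr x) (outer_trace t tr x) \<partial>\<Omega>_face \<xi> 1)
        - (\<integral>x. flux_form \<xi> (outer_trace t tr x) (outer_trace t tr x) \<partial>\<Omega>_face \<xi> (- 1))" for \<xi>
  proof -
    have "t \<xi> (Suc (i \<xi>)) = 1" if "i \<xi> = n \<xi> - 1" for i
      using that grid_pos[OF grid, of \<xi>] grid_ends[OF grid, of \<xi>] by simp
    then have up: "(\<integral>x. ?f \<xi> (cell_at t x) x \<partial>\<Omega>_face \<xi> 1) = (\<Sum>i\<in>{i \<in> cells n. i \<xi> = n \<xi> - 1}. U \<xi> i)"
      unfolding U_def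
      by (subst integral_outer_face[OF grid meas int cell_at_upper_face[OF grid]]) auto
    have "t \<xi> (i \<xi>) = - 1" if "i \<xi> = 0" for i
      using that grid_ends[OF grid, of \<xi>] by simp
    then have low: "(\<integral>x. ?f \<xi> (cell_at t x) x \<partial>\<Omega>_face \<xi> (- 1)) = (\<Sum>i\<in>{i \<in> cells n. i \<xi> = 0}. L \<xi> i)"
      unfolding L_def
      by (subst integral_outer_face[OF grid meas int cell_at_lower_face[OF grid]]) auto
    show ?thesis
      unfolding outer_trace_def up low
      by (rule sum_cells_telescope[where \<xi> = \<xi>, OF grid_pos[OF grid] shared])
  qed
  have "(\<Sum>i\<in>cells n. \<Sum>\<xi>\<in>UNIV. \<integral>x. flux_form \<xi> (Q x) (DQ \<xi> x) \<partial>lebesgue_on (box (lower t i) (upper t i)))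
      = (\<Sum>i\<in>cells n. \<Sum>\<xi>\<in>UNIV. (U \<xi> i - L \<xi> i) / 2)"
    by (intro sum.cong refl) (simp add: balance[symmetric])
  also have "\<dots> = (\<Sum>\<xi>\<in>UNIV. (\<Sum>i\<in>cells n. U \<xi> i - L \<xi> i) / 2)"
    by (subst sum.swap) (simp add: sum_divide_distrib)
  finally show ?thesis
    by (simp add: boundary_term_flux_form outer)
qed

text \<open>The boundary condition at \<open>\<xi> = -1\<close> is the one at \<open>\<xi> = 1\<close> with \<open>- T\<close> in place of \<open>T\<close>, which
compensates the opposite sign of the lower faces in the boundary term.\<close>

lemma boundary_term_nonpos:
  assumes Z: "\<And>x \<xi> \<eta>. x \<in> \<Omega> \<Longrightarrow> Z x \<xi> \<eta> > 0" and gamma: "\<And>\<eta>. \<bar>\<gamma> \<eta>\<bar> \<le> 1"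
    and lower: "\<And>\<xi>. AE x in \<Omega>_face \<xi> (- 1). \<forall>\<eta>.
         of_real (Z x \<xi> \<eta> / 2 * (1 - \<gamma> \<eta>)) * velocity (q x) $ \<eta>
         - of_real ((1 + \<gamma> \<eta>) / 2) * traction \<xi> (q x) $ \<eta> = 0"
    and upper: "\<And>\<xi>. AE x in \<Omega>_face \<xi> 1. \<forall>\<eta>.
         of_real (Z x \<xi> \<eta> / 2 * (1 - \<gamma> \<eta>)) * velocity (q x) $ \<eta>
         + of_real ((1 + \<gamma> \<eta>) / 2) * traction \<xi> (q x) $ \<eta> = 0"
  shows "boundary_term q \<le> 0"
proof -
  have "(\<integral>x. flux_form \<xi> (q x) (q x) \<partial>\<Omega>_face \<xi> 1) \<le> 0" for \<xi>
  proof -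
    have "AE x in \<Omega>_face \<xi> 1. 0 \<le> - flux_form \<xi> (q x) (q x)"
      using upper[of \<xi>] unfolding AE_face_measure
    proof eventually_elim
      case (elim x)
      show ?case
      proof
        assume x: "x \<in> cbox (vec (- 1)) (vec 1)"
        have "Re (cnj (velocity (q x) $ \<eta>) * traction \<xi> (q x) $ \<eta>) \<le> 0" for \<eta>
          using x elim by (intro reflecting_boundary_sign[OF Z gamma]) (auto simp: \<Omega>_def)
        then show "0 \<le> - flux_form \<xi> (q x) (q x)"
          unfolding flux_form_velocity_traction by (simp add: sum_nonpos)
      qed
    qed
    then have "0 \<le> (\<integral>x. - flux_form \<xi> (q x) (q x) \<partial>\<Omega>_face \<xi> 1)"
      by (rule integral_nonneg_AE)
    then show ?thesis by simp
  qed
  moreover have "0 \<le> (\<integral>x. flux_form \<xi> (q x) (q x) \<partial>\<Omega>_face \<xi> (- 1))" for \<xi>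
  proof (rule integral_nonneg_AE)
    show "AE x in \<Omega>_face \<xi> (- 1). 0 \<le> flux_form \<xi> (q x) (q x)"
      using lower[of \<xi>] unfolding AE_face_measure
    proof eventually_elim
      case (elim x)
      show ?case
      proof
        assume x: "x \<in> cbox (vec (- 1)) (vec 1)"
        have "Re (cnj (velocity (q x) $ \<eta>) * (- traction \<xi> (q x) $ \<eta>)) \<le> 0" for \<eta>
          using x elim by (intro reflecting_boundary_sign[OF Z gamma]) (auto simp: \<Omega>_def)
        then have "0 \<le> Re (cnj (velocity (q x) $ \<eta>) * traction \<xi> (q x) $ \<eta>)" for \<eta>
          by (simp only: mult_minus_right uminus_complex.sel neg_le_0_iff_le)
        then show "0 \<le> flux_form \<xi> (q x) (q x)"
          unfolding flux_form_velocity_traction by (intro mult_nonneg_nonneg sum_nonneg) simp_all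
      qed
    qed
  qed
  ultimately show ?thesis
    unfolding boundary_term_flux_form
    by (intro sum_nonpos) (smt (verit) divide_nonpos_pos)
qed

section \<open>The weighted norm and the energy estimate\<close>

text \<open>The weighted norm is built on a complex integral; here it is reduced to the integral of the real
energy density, on which the estimates operate.\<close>

lemma P_norm_eq:
  assumes M: "\<And>x. x \<in> \<Omega> \<Longrightarrow> sym_pos_def (P x)"
    and int: "integrable (lebesgue_on \<Omega>) (\<lambda>x. hdot (u x) (cmat (matrix_inv (P x)) *v u x))"
  shows "(P_norm P u)\<^sup>2 = 1 / 2 * (\<integral>x. Re (hdot (u x) (cmat (matrix_inv (P x)) *v u x)) \<partial>lebesgue_on \<Omega>)"
    and "P_norm P u = sqrt (1 / 2 * (\<integral>x. Re (hdot (u x) (cmat (matrix_inv (P x)) *v u x)) \<partial>lebesgue_on \<Omega>))"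
    and "0 \<le> (\<integral>x. Re (hdot (u x) (cmat (matrix_inv (P x)) *v u x)) \<partial>lebesgue_on \<Omega>)"
proof -
  let ?q = "\<lambda>x. hdot (u x) (cmat (matrix_inv (P x)) *v u x)"
  have "Re (P_inner P u u) = Re (1 / 2 * (\<integral>x. ?q x \<partial>lebesgue_on \<Omega>))"
    unfolding P_inner_def by (subst integral_mult_right_zero) simp
  also have "\<dots> = 1 / 2 * (\<integral>x. Re (?q x) \<partial>lebesgue_on \<Omega>)"
    using int by simp
  finally show n: "P_norm P u = sqrt (1 / 2 * (\<integral>x. Re (?q x) \<partial>lebesgue_on \<Omega>))"
    by (simp add: P_norm_def)
  show nn: "0 \<le> (\<integral>x. Re (?q x) \<partial>lebesgue_on \<Omega>)"
    using M by (intro Bochner_Integration.integral_nonneg sym_pos_def_hdot_nonneg sym_pos_def_matrix_inv(3))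
      (auto simp: space_restrict_space)
  show "(P_norm P u)\<^sup>2 = 1 / 2 * (\<integral>x. Re (?q x) \<partial>lebesgue_on \<Omega>)"
    unfolding n using nn by simp
qed

text \<open>The energy of \<open>r u + w\<close> is a nonnegative quadratic polynomial in the real number \<open>r\<close>.\<close>

lemma P_norm_Cauchy_Schwarz:
  assumes M: "\<And>x. x \<in> \<Omega> \<Longrightarrow> sym_pos_def (P x)"
    and u: "integrable (lebesgue_on \<Omega>) (\<lambda>x. hdot (u x) (cmat (matrix_inv (P x)) *v u x))"
    and w: "integrable (lebesgue_on \<Omega>) (\<lambda>x. hdot (w x) (cmat (matrix_inv (P x)) *v w x))"
    and uw: "integrable (lebesgue_on \<Omega>) (\<lambda>x. hdot (u x) (cmat (matrix_inv (P x)) *v w x))"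
  shows "1 / 2 * (\<integral>x. Re (hdot (u x) (cmat (matrix_inv (P x)) *v w x)) \<partial>lebesgue_on \<Omega>) \<le> P_norm P u * P_norm P w"
proof -
  let ?h = "\<lambda>p q x. Re (hdot (p x) (cmat (matrix_inv (P x)) *v q x))"
  let ?I = "\<lambda>p q. 1 / 2 * (\<integral>x. ?h p q x \<partial>lebesgue_on \<Omega>)"
  have int: "integrable (lebesgue_on \<Omega>) (?h u u)" "integrable (lebesgue_on \<Omega>) (?h w w)"
      "integrable (lebesgue_on \<Omega>) (?h u w)"
    using u w uw by auto
  have "0 \<le> ?I u u * r\<^sup>2 + 2 * ?I u w * r + ?I w w" for r
  proof -
    have "0 \<le> (\<integral>x. ?h u u x * r\<^sup>2 + ?h u w x * (2 * r) + ?h w w x \<partial>lebesgue_on \<Omega>)"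
    proof (rule Bochner_Integration.integral_nonneg)
      fix x assume "x \<in> space (lebesgue_on \<Omega>)"
      then have inv: "sym_pos_def (matrix_inv (P x))"
        using M by (auto simp: space_restrict_space sym_pos_def_matrix_inv)
      then have "0 \<le> ?h (\<lambda>x. of_real r *s u x + w x) (\<lambda>x. of_real r *s u x + w x) x"
        by (rule sym_pos_def_hdot_nonneg)
      also have "\<dots> = ?h u u x * r\<^sup>2 + ?h u w x * r + ?h w u x * r + ?h w w x"
        by (simp add: hdot_add_left hdot_add_right hdot_smult_left hdot_smult_right
            matrix_vector_right_distrib vector_scalar_commute power2_eq_square algebra_simps)
      also have "?h w u x = ?h u w x"
        using inv by (subst hdot_symmetric_matrix) (simp_all add: sym_pos_def_def)
      finally show "0 \<le> ?h u u x * r\<^sup>2 + ?h u w x * (2 * r) + ?h w w x"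
        by (simp add: mult_ac)
    qed
    also have "\<dots> = (\<integral>x. ?h u u x \<partial>lebesgue_on \<Omega>) * r\<^sup>2 + (\<integral>x. ?h u w x \<partial>lebesgue_on \<Omega>) * (2 * r)
        + (\<integral>x. ?h w w x \<partial>lebesgue_on \<Omega>)"
      using int by simp
    finally show ?thesis by (simp add: algebra_simps)
  qed
  then have "\<bar>?I u w\<bar> \<le> sqrt (?I u u) * sqrt (?I w w)"
    using P_norm_eq(3)[OF M u] P_norm_eq(3)[OF M w] by (intro nonneg_quadratic_bound) auto
  also have "sqrt (?I u u) = P_norm P u"
    by (rule P_norm_eq(2)[OF M u, symmetric])
  also have "sqrt (?I w w) = P_norm P w"
    by (rule P_norm_eq(2)[OF M w, symmetric])
  finally show ?thesis
    by (rule order_trans[OF abs_ge_self])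
qed

theorem theorem3:
  fixes \<rho> cp cs d :: "real ^ 3 \<Rightarrow> real"
    and C :: "real ^ 3 \<Rightarrow> real ^ 6 ^ 6"
    and P :: "real ^ 3 \<Rightarrow> real ^ (3 + 6) ^ (3 + 6)"
    and \<alpha> a :: real
    and \<gamma> :: "3 \<Rightarrow> real"
    and s :: complex
    and n :: "3 \<Rightarrow> nat" and t :: "3 \<Rightarrow> nat \<Rightarrow> real"
    and Q FQ F :: "real ^ 3 \<Rightarrow> state"
    and Fw DQ :: "3 \<Rightarrow> real ^ 3 \<Rightarrow> state"
    and tr :: "(3 \<Rightarrow> nat) \<Rightarrow> real ^ 3 \<Rightarrow> state"
    and Qb :: "real ^ 3 \<Rightarrow> state"
  defines "P \<equiv> \<lambda>x. P_mat (\<rho> x) (C x)"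
    and "F \<equiv> \<lambda>x. pml_source (P x) (d x) \<alpha> s (FQ x) (\<lambda>\<xi>. Fw \<xi> x)"
    and "Qb \<equiv> outer_trace t tr"
  assumes material:
      "\<rho> \<in> borel_measurable (lebesgue_on \<Omega>)" "C \<in> borel_measurable (lebesgue_on \<Omega>)"
      "\<And>x. x \<in> \<Omega> \<Longrightarrow> \<rho> x > 0" "\<And>x. x \<in> \<Omega> \<Longrightarrow> sym_pos_def (C x)"
      "\<And>x. x \<in> \<Omega> \<Longrightarrow> cp x > 0" "\<And>x. x \<in> \<Omega> \<Longrightarrow> cs x > 0"
    and grid: "is_grid n t"
    and damping: "\<And>x. x \<in> \<Omega> \<Longrightarrow> d x \<ge> 0"
      "\<And>i. i \<in> cells n \<Longrightarrow> d constant_on box (lower t i) (upper t i)" "\<alpha> \<ge> 0"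
    and sources: "L2 (lebesgue_on \<Omega>) FQ" "\<And>\<xi>. L2 (lebesgue_on \<Omega>) (Fw \<xi>)"
      "integrable (lebesgue_on \<Omega>) (\<lambda>x. hdot (F x) (cmat (matrix_inv (P x)) *v F x))"
    and gamma: "\<And>\<eta>. \<bar>\<gamma> \<eta>\<bar> \<le> 1"
    and s: "a > 0" "Re s \<ge> a"
    and regularity:
      "\<And>i. i \<in> cells n \<Longrightarrow> H1_on (box (lower t i) (upper t i)) Q DQ"
      "\<And>i. i \<in> cells n \<Longrightarrow> has_trace (lower t i) (upper t i) Q DQ (tr i)"
    and equation:
      "\<And>i. i \<in> cells n \<Longrightarrow> AE x in lebesgue_on (box (lower t i) (upper t i)).
         (s * pml_S (d x) \<alpha> s) *s (cmat (matrix_inv (P x)) *v Q x)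
         = (\<Sum>\<xi>\<in>UNIV. cmat (A_mat \<xi>) *v DQ \<xi> x) + cmat (matrix_inv (P x)) *v F x"
    and boundary_lower:
      "\<And>\<xi>. AE x in \<Omega>_face \<xi> (- 1). \<forall>\<eta>.
         of_real (impedance (\<rho> x) (cp x) (cs x) \<xi> \<eta> / 2 * (1 - \<gamma> \<eta>)) * velocity (Qb x) $ \<eta>
         - of_real ((1 + \<gamma> \<eta>) / 2) * traction \<xi> (Qb x) $ \<eta> = 0"
    and boundary_upper:
      "\<And>\<xi>. AE x in \<Omega>_face \<xi> 1. \<forall>\<eta>.
         of_real (impedance (\<rho> x) (cp x) (cs x) \<xi> \<eta> / 2 * (1 - \<gamma> \<eta>)) * velocity (Qb x) $ \<eta>
         + of_real ((1 + \<gamma> \<eta>) / 2) * traction \<xi> (Qb x) $ \<eta> = 0"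
    and interface:
      "\<And>i j \<xi>. i \<in> cells n \<Longrightarrow> j \<in> cells n \<Longrightarrow> j = i(\<xi> := Suc (i \<xi>)) \<Longrightarrow>
         AE x in face_measure \<xi> (t \<xi> (Suc (i \<xi>))) (lower t i) (upper t i).
           traction \<xi> (tr j x) = traction \<xi> (tr i x) \<and>
           velocity (tr j x) - velocity (tr i x) = 0"
  shows "(\<forall>x\<in>\<Omega>. Re (s * pml_S (d x) \<alpha> s) \<ge> a) \<and>
    (P_norm P (\<lambda>x. complex_of_real (sqrt (Re (s * pml_S (d x) \<alpha> s))) *s Q x))\<^sup>2
      \<le> P_norm P Q * P_norm P F + boundary_term Qb / 2 \<and>
    boundary_term Qb \<le> 0"
proof -
  \<comment> \<open>The source before multiplication by \<open>P\<close>, that is \<open>P\<close> inverse applied to \<open>F\<close>; it is square integrable on each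
    cell, while \<open>F\<close> need not be.\<close>
  define G where "G x = pml_S (d x) \<alpha> s *s FQ x - (\<Sum>\<xi>\<in>UNIV. (of_real (d x) / (s + of_real \<alpha>)) *s Fw \<xi> x)" for x
  let ?M = "\<lambda>x. cmat (matrix_inv (P x))"
  let ?r = "\<lambda>x. Re (s * pml_S (d x) \<alpha> s)"
  let ?q = "\<lambda>x. Re (hdot (Q x) (?M x *v Q x))"
  let ?box = "\<lambda>i. box (lower t i) (upper t i)"
  have spd: "sym_pos_def (P x)" if "x \<in> \<Omega>" for x
    unfolding P_def using material that by (intro sym_pos_def_P_mat)
  have MF: "?M x *v F x = G x" if "x \<in> \<Omega>" for x
  proof -
    have "F x = cmat (P x) *v G x"
      by (simp add: F_def G_def pml_source_def)
    then show ?thesis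
      by (simp add: matrix_vector_mul_assoc cmat_mult[symmetric] sym_pos_def_matrix_inv(2)[OF spd[OF that]] cmat_mat_1)
  qed
  have damped: "a \<le> ?r x" if "x \<in> \<Omega>" for x
    using pml_S_damping[OF damping(1)[OF that] damping(3), of s] s by linarith
  have q_real: "hdot (Q x) (?M x *v Q x) = of_real (?q x)" if "x \<in> \<Omega>" for x
    using sym_pos_def_matrix_inv(3)[OF spd[OF that]]
    by (intro hdot_symmetric_matrix_real) (simp add: sym_pos_def_def)
  have \<Omega>_sets: "\<Omega> \<in> sets lebesgue" and box_sets: "?box i \<in> sets lebesgue" for i
    by (simp_all add: \<Omega>_def)

  have cell: "integrable (lebesgue_on (?box i)) (\<lambda>x. hdot (Q x) (G x))"
      "integrable (lebesgue_on (?box i)) (\<lambda>x. hdot (Q x) (?M x *v Q x))"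
      "integrable (lebesgue_on (?box i)) (\<lambda>x. ?r x * ?q x)"
      "(\<integral>x. ?r x * ?q x \<partial>lebesgue_on (?box i))
        = (\<Sum>\<xi>\<in>UNIV. \<integral>x. flux_form \<xi> (Q x) (DQ \<xi> x) \<partial>lebesgue_on (?box i))
          + (\<integral>x. Re (hdot (Q x) (G x)) \<partial>lebesgue_on (?box i))"
    if i: "i \<in> cells n" for i
  proof -
    have sub: "?box i \<subseteq> \<Omega>"
      using cell_subset_\<Omega>[OF grid i] box_subset_cbox by blast
    obtain d0 where d0: "\<And>x. x \<in> ?box i \<Longrightarrow> d x = d0"
      using damping(2)[OF i] by (auto simp: constant_on_def)
    define k where "k = s * pml_S d0 \<alpha> s"
    have L2_Q: "L2 (lebesgue_on (?box i)) Q" and L2_DQ: "L2 (lebesgue_on (?box i)) (DQ \<xi>)" for \<xi>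
      using regularity(1)[OF i] by (auto simp: H1_on_def)
    have L2_F: "L2 (lebesgue_on (?box i)) FQ" "L2 (lebesgue_on (?box i)) (Fw \<xi>)" for \<xi>
      using sources(1,2) by (auto intro: L2_lebesgue_on_subset[OF _ box_sets \<Omega>_sets sub])
    have "integrable (lebesgue_on (?box i)) (\<lambda>x. pml_S d0 \<alpha> s * hdot (Q x) (FQ x)
        - (\<Sum>\<xi>\<in>UNIV. of_real d0 / (s + of_real \<alpha>) * hdot (Q x) (Fw \<xi> x)))"
      using L2_F by (intro Bochner_Integration.integrable_diff Bochner_Integration.integrable_sum
          integrable_mult_right L2_integrable_bilinear[OF bounded_bilinear_hdot L2_Q])
    then show int_G: "integrable (lebesgue_on (?box i)) (\<lambda>x. hdot (Q x) (G x))"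
      by (rule Bochner_Integration.integrable_cong[THEN iffD1, rotated 2])
        (auto simp: space_restrict_space G_def d0 hdot_diff_right hdot_sum_right hdot_smult_right)
    have int_A: "integrable (lebesgue_on (?box i)) (\<lambda>x. hdot (Q x) (cmat (A_mat \<xi>) *v DQ \<xi> x))" for \<xi>
      by (rule L2_integrable_bilinear[OF bounded_bilinear_hdot_matrix L2_Q L2_DQ])
    have tested: "AE x in lebesgue_on (?box i). x \<in> ?box i \<and> k * hdot (Q x) (?M x *v Q x)
        = (\<Sum>\<xi>\<in>UNIV. hdot (Q x) (cmat (A_mat \<xi>) *v DQ \<xi> x)) + hdot (Q x) (G x)"
      using equation[OF i] AE_space
    proof eventually_elim
      case (elim x)
      then have x: "x \<in> ?box i" by (simp add: space_restrict_space)
      with sub have "x \<in> \<Omega>" by blast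
      with elim(1) x have "k *s (?M x *v Q x) = (\<Sum>\<xi>\<in>UNIV. cmat (A_mat \<xi>) *v DQ \<xi> x) + G x"
        by (simp add: k_def d0 MF)
      from arg_cong[OF this, of "hdot (Q x)"] x show ?case
        by (simp add: hdot_smult_right hdot_add_right hdot_sum_right)
    qed
    \<comment> \<open>The bound on \<open>Re (s S)\<close> is known on \<open>\<Omega>\<close>, so a point of the cell is needed to apply it to \<open>k\<close>.\<close>
    have "Re k > 0"
    proof -
      have "lower t i $ \<eta> < upper t i $ \<eta>" for \<eta>
        using i by (auto simp: lower_def upper_def cells_def Suc_le_eq intro!: grid_less[OF grid])
      then have "?box i \<noteq> {}"
        by (simp add: interval_ne_empty_cart)
      then obtain x where "x \<in> ?box i" by blast
      then show ?thesis using damped[of x] s sub d0 by (auto simp: k_def)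
    qed
    then have "k \<noteq> 0" by auto
    \<comment> \<open>The equation, divided by \<open>k\<close>, makes the weighted energy density equal almost everywhere to an integrable function.\<close>
    let ?rhs = "\<lambda>x. 1 / k * ((\<Sum>\<xi>\<in>UNIV. hdot (Q x) (cmat (A_mat \<xi>) *v DQ \<xi> x)) + hdot (Q x) (G x))"
    have "AE x in lebesgue_on (?box i). ?rhs x = hdot (Q x) (?M x *v Q x)"
      using tested by eventually_elim (use \<open>k \<noteq> 0\<close> in \<open>simp add: field_simps\<close>)
    moreover have "integrable (lebesgue_on (?box i)) ?rhs"
      by (rule integrable_mult_right, rule Bochner_Integration.integrable_add[OF _ int_G],
          rule Bochner_Integration.integrable_sum, rule int_A)
    ultimately show "integrable (lebesgue_on (?box i)) (\<lambda>x. hdot (Q x) (?M x *v Q x))"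
      by (rule lebesgue_on_cong_AE(1)[OF box_sets, rotated])
    let ?e = "\<lambda>x. (\<Sum>\<xi>\<in>UNIV. flux_form \<xi> (Q x) (DQ \<xi> x)) + Re (hdot (Q x) (G x))"
    have int_flux: "integrable (lebesgue_on (?box i)) (\<lambda>x. flux_form \<xi> (Q x) (DQ \<xi> x))" for \<xi>
      unfolding flux_form_def using int_A by (rule integrable_Re)
    then have int_e: "integrable (lebesgue_on (?box i)) ?e"
      using int_G by (intro Bochner_Integration.integrable_add Bochner_Integration.integrable_sum integrable_Re)
    have ae: "AE x in lebesgue_on (?box i). ?e x = ?r x * ?q x"
      using tested
    proof eventually_elim
      case (elim x)
      then have "x \<in> \<Omega>" "d x = d0" using sub d0 by auto
      have "?e x = Re (k * hdot (Q x) (?M x *v Q x))"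
        using elim by (simp add: flux_form_def Re_sum)
      also have "\<dots> = Re (k * of_real (?q x))"
        by (subst q_real[OF \<open>x \<in> \<Omega>\<close>]) simp
      finally show ?case by (simp add: k_def \<open>d x = d0\<close>)
    qed
    show "integrable (lebesgue_on (?box i)) (\<lambda>x. ?r x * ?q x)"
      by (rule lebesgue_on_cong_AE(1)[OF box_sets int_e ae])
    have "(\<integral>x. ?r x * ?q x \<partial>lebesgue_on (?box i)) = (\<integral>x. ?e x \<partial>lebesgue_on (?box i))"
      by (rule lebesgue_on_cong_AE(2)[OF box_sets int_e ae])
    also have "\<dots> = (\<Sum>\<xi>\<in>UNIV. \<integral>x. flux_form \<xi> (Q x) (DQ \<xi> x) \<partial>lebesgue_on (?box i))
          + (\<integral>x. Re (hdot (Q x) (G x)) \<partial>lebesgue_on (?box i))"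
      using int_flux int_G by simp
    finally show "(\<integral>x. ?r x * ?q x \<partial>lebesgue_on (?box i))
        = (\<Sum>\<xi>\<in>UNIV. \<integral>x. flux_form \<xi> (Q x) (DQ \<xi> x) \<partial>lebesgue_on (?box i))
          + (\<integral>x. Re (hdot (Q x) (G x)) \<partial>lebesgue_on (?box i))" .
  qed

  have int_G: "integrable (lebesgue_on \<Omega>) (\<lambda>x. hdot (Q x) (G x))"
    and int_q: "integrable (lebesgue_on \<Omega>) (\<lambda>x. hdot (Q x) (?M x *v Q x))"
    and int_rq: "integrable (lebesgue_on \<Omega>) (\<lambda>x. ?r x * ?q x)"
    using cell by (auto intro!: integral_sum_cells(1)[OF grid])
  have energy: "(\<integral>x. ?r x * ?q x \<partial>lebesgue_on \<Omega>)
      = boundary_term Qb + (\<integral>x. Re (hdot (Q x) (G x)) \<partial>lebesgue_on \<Omega>)"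
  proof -
    have "(\<integral>x. Re (hdot (Q x) (G x)) \<partial>lebesgue_on \<Omega>)
        = (\<Sum>i\<in>cells n. \<integral>x. Re (hdot (Q x) (G x)) \<partial>lebesgue_on (?box i))"
      using cell(1) by (intro integral_sum_cells(2)[OF grid] integrable_Re)
    moreover have "(\<integral>x. ?r x * ?q x \<partial>lebesgue_on \<Omega>) = (\<Sum>i\<in>cells n. \<integral>x. ?r x * ?q x \<partial>lebesgue_on (?box i))"
      by (rule integral_sum_cells(2)[OF grid cell(3)])
    moreover have "\<dots> = (\<Sum>i\<in>cells n. (\<Sum>\<xi>\<in>UNIV. \<integral>x. flux_form \<xi> (Q x) (DQ \<xi> x) \<partial>lebesgue_on (?box i))
          + (\<integral>x. Re (hdot (Q x) (G x)) \<partial>lebesgue_on (?box i)))"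
      by (rule sum.cong[OF refl cell(4)])
    moreover have "(\<Sum>i\<in>cells n. \<Sum>\<xi>\<in>UNIV. \<integral>x. flux_form \<xi> (Q x) (DQ \<xi> x) \<partial>lebesgue_on (?box i))
        = boundary_term Qb"
      unfolding Qb_def by (rule piecewise_H1_flux_balance[OF grid regularity(2) interface])
    ultimately show ?thesis
      by (simp only: sum.distrib)
  qed

  let ?u = "\<lambda>x. complex_of_real (sqrt (?r x)) *s Q x"
  have u: "hdot (?u x) (?M x *v ?u x) = of_real (?r x * ?q x)" if "x \<in> \<Omega>" for x
  proof -
    have "hdot (of_real b *s y) (?M x *v (of_real b *s y)) = of_real (b * b) * hdot y (?M x *v y)" for b y
      by (simp add: hdot_smult_left hdot_smult_right vector_scalar_commute)
    then have "hdot (?u x) (?M x *v ?u x) = of_real (sqrt (?r x) * sqrt (?r x)) * hdot (Q x) (?M x *v Q x)" .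
    also have "sqrt (?r x) * sqrt (?r x) = ?r x"
      using damped[OF that] s by (intro real_sqrt_mult_self[THEN trans] abs_of_nonneg) linarith
    also have "hdot (Q x) (?M x *v Q x) = of_real (?q x)"
      by (rule q_real[OF that])
    finally show ?thesis by (simp only: of_real_mult)
  qed
  have "integrable (lebesgue_on \<Omega>) (\<lambda>x. complex_of_real (?r x * ?q x))"
    using int_rq by (rule integrable_of_real)
  then have int_u: "integrable (lebesgue_on \<Omega>) (\<lambda>x. hdot (?u x) (?M x *v ?u x))"
    by (rule Bochner_Integration.integrable_cong[THEN iffD1, rotated 2])
      (simp_all only: space_lebesgue_on u)
  have "(P_norm P ?u)\<^sup>2 = 1 / 2 * (\<integral>x. Re (hdot (?u x) (?M x *v ?u x)) \<partial>lebesgue_on \<Omega>)"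
    by (rule P_norm_eq(1)[OF spd int_u])
  also have "(\<integral>x. Re (hdot (?u x) (?M x *v ?u x)) \<partial>lebesgue_on \<Omega>) = (\<integral>x. ?r x * ?q x \<partial>lebesgue_on \<Omega>)"
    by (rule Bochner_Integration.integral_cong) (simp_all only: space_lebesgue_on u Re_complex_of_real)
  also note energy
  finally have lhs: "(P_norm P ?u)\<^sup>2
      = boundary_term Qb / 2 + 1 / 2 * (\<integral>x. Re (hdot (Q x) (G x)) \<partial>lebesgue_on \<Omega>)"
    unfolding distrib_left by linarith
  have int_F: "integrable (lebesgue_on \<Omega>) (\<lambda>x. hdot (Q x) (?M x *v F x))"
    by (rule Bochner_Integration.integrable_cong[THEN iffD2, OF refl _ int_G])
      (simp only: space_lebesgue_on MF)
  have F_eq_G: "(\<integral>x. Re (hdot (Q x) (?M x *v F x)) \<partial>lebesgue_on \<Omega>)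
      = (\<integral>x. Re (hdot (Q x) (G x)) \<partial>lebesgue_on \<Omega>)"
    by (rule Bochner_Integration.integral_cong) (simp_all only: space_lebesgue_on MF)
  have "1 / 2 * (\<integral>x. Re (hdot (Q x) (G x)) \<partial>lebesgue_on \<Omega>) \<le> P_norm P Q * P_norm P F"
    using P_norm_Cauchy_Schwarz[OF spd int_q sources(3) int_F] unfolding F_eq_G .
  with lhs have "(P_norm P ?u)\<^sup>2 \<le> P_norm P Q * P_norm P F + boundary_term Qb / 2"
    by linarith
  moreover have "boundary_term Qb \<le> 0"
  proof (rule boundary_term_nonpos[OF _ gamma boundary_lower boundary_upper])
    show "impedance (\<rho> x) (cp x) (cs x) \<xi> \<eta> > 0" if "x \<in> \<Omega>" for x \<xi> \<eta>
      using material(3,5,6)[OF that] by (simp add: impedance_def)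
  qed
  ultimately show ?thesis
    using damped by blast
qed

end
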